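(* Consider the splittable variant, an instance $I$ and a makespan $T\ge T_{\min}:=\max\{N/m,s_{\max}\}$. Let $\beta_i=\lceil 2P(C_i)/T\rceil$, \[L_{\mathrm{split}}=P(J)+\sum_{i\in I_{\mathrm{chp}}}s_i+\sum_{i\in I_{\exp}}\beta_is_i\] and $m_{\exp}=\sum_{i\in I_{\exp}}\beta_i$. Then: (i) if $mT<L_{\mathrm{split}}$ or $m<m_{\exp}$, then $T<\mathrm{OPT}_{\mathrm{split}}(I)$; (ii) otherwise a feasible splittable schedule with makespan at most $\tfrac32T$ can be computed in time $\mathcal{O}(n)$.
   Context: An instance consists of $m$ identical machines, $n$ jobs $J$, a partition $J=C_1\,\dot\cup\dots\dot\cup\,C_c$ into nonempty classes, processing times $t_j\in\mathbb{N}$, setup times $s_i\in\mathbb{N}$. On each machine one item at a time; a setup of class $i$ (length $s_i$) is required whenever a machine starts processing load of class $i$ or switches to class $i$ from a different class; setups are not preempted. Splittable variant: jobs may be split into arbitrarily many pieces processed on any machines at any times, also in parallel; a schedule may be represented by machine configurations with multiplicities. $\mathrm{OPT}_{\mathrm{split}}(I)$ is the minimum makespan. $P(K)=\sum_{j\in K}t_j$, $N=\sum_i s_i+P(J)$, $s_{\max}=\max_i s_i$. Expensive classes $I_{\exp}=\{i:s_i>T/2\}$, cheap classes $I_{\mathrm{chp}}=\{i:s_i\le T/2\}$. *)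

theory Defs
  imports Complex_Main
begin

section \<open>Instances\<close>

text \<open>
  Machines, jobs and classes are numbered from 0; \<open>cls j\<close> is the class of job \<open>j\<close>, so that the
  partition of the jobs is given by the sets \<open>class_jobs I i\<close> below. Values of \<open>cls\<close>, \<open>ptime\<close> and
  \<open>stime\<close> outside the respective index ranges are irrelevant.
\<close>

record inst =
  machines :: nat
  jobs :: nat
  classes :: nat
  cls :: "nat \<Rightarrow> nat"
  ptime :: "nat \<Rightarrow> nat"
  stime :: "nat \<Rightarrow> nat"

definition class_jobs :: "inst \<Rightarrow> nat \<Rightarrow> nat set" where
  "class_jobs I i = {j. j < jobs I \<and> cls I j = i}"

text \<open>
  Processing times are positive: with \<open>0\<close> admitted, a class without any load would contribute its
  setup time to \<open>L_split\<close> (if it is cheap) although no machine has to process it.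
\<close>

definition wf_inst :: "inst \<Rightarrow> bool" where
  "wf_inst I \<longleftrightarrow>
     0 < machines I \<and> 0 < jobs I \<and>
     (\<forall>j < jobs I. cls I j < classes I \<and> 0 < ptime I j) \<and>
     (\<forall>i < classes I. class_jobs I i \<noteq> {})"

definition load :: "inst \<Rightarrow> nat set \<Rightarrow> nat" where
  "load I K = (\<Sum>j\<in>K. ptime I j)"

definition total_N :: "inst \<Rightarrow> nat" where
  "total_N I = (\<Sum>i<classes I. stime I i) + load I {..<jobs I}"

definition s_max :: "inst \<Rightarrow> nat" where
  "s_max I = Max (stime I ` {..<classes I})"

definition T_min :: "inst \<Rightarrow> real" where
  "T_min I = max (real (total_N I) / real (machines I)) (real (s_max I))"

definition I_exp :: "inst \<Rightarrow> real \<Rightarrow> nat set" where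
  "I_exp I T = {i. i < classes I \<and> real (stime I i) > T / 2}"

definition I_chp :: "inst \<Rightarrow> real \<Rightarrow> nat set" where
  "I_chp I T = {i. i < classes I \<and> real (stime I i) \<le> T / 2}"

definition beta :: "inst \<Rightarrow> real \<Rightarrow> nat \<Rightarrow> int" where
  "beta I T i = \<lceil>2 * real (load I (class_jobs I i)) / T\<rceil>"

definition L_split :: "inst \<Rightarrow> real \<Rightarrow> int" where
  "L_split I T = int (load I {..<jobs I}) + (\<Sum>i\<in>I_chp I T. int (stime I i))
     + (\<Sum>i\<in>I_exp I T. beta I T i * int (stime I i))"

definition m_exp :: "inst \<Rightarrow> real \<Rightarrow> int" where
  "m_exp I T = (\<Sum>i\<in>I_exp I T. beta I T i)"

section \<open>Splittable schedules\<close>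

text \<open>
  \<open>Setup i a\<close> is a setup of class \<open>i\<close> started at time \<open>a\<close> (it runs for the whole setup time, as
  setups are not preempted); \<open>Piece j a l\<close> processes job \<open>j\<close> during \<open>[a, a + l]\<close>.
  A schedule has one list of items, in temporal order, for each machine.
\<close>

datatype item = Setup nat real | Piece nat real real

type_synonym sched = "item list list"

text \<open>
  \<open>machine_ok I k x M\<close>: the items in \<open>M\<close> can be executed one after the other on a machine that is
  busy up to time \<open>x\<close> and currently set up for class \<open>k\<close> (\<open>None\<close>: for no class yet). Any setup
  replaces the current one, which otherwise survives idle times.
\<close>

fun machine_ok :: "inst \<Rightarrow> nat option \<Rightarrow> real \<Rightarrow> item list \<Rightarrow> bool" where
  "machine_ok I k x [] \<longleftrightarrow> True"
| "machine_ok I k x (Setup i a # M) \<longleftrightarrow>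
     i < classes I \<and> x \<le> a \<and> machine_ok I (Some i) (a + real (stime I i)) M"
| "machine_ok I k x (Piece j a l # M) \<longleftrightarrow>
     j < jobs I \<and> k = Some (cls I j) \<and> x \<le> a \<and> 0 \<le> l \<and> machine_ok I k (a + l) M"

fun amount :: "nat \<Rightarrow> item \<Rightarrow> real" where
  "amount j (Setup i a) = 0"
| "amount j (Piece j' a l) = (if j' = j then l else 0)"

text \<open>Pieces of one job on different machines may overlap in time (splittable variant).\<close>

definition feasible :: "inst \<Rightarrow> sched \<Rightarrow> bool" where
  "feasible I S \<longleftrightarrow>
     length S = machines I \<and>
     (\<forall>M \<in> set S. machine_ok I None 0 M) \<and>
     (\<forall>j < jobs I. (\<Sum>M\<leftarrow>S. \<Sum>x\<leftarrow>M. amount j x) = real (ptime I j))"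

fun item_end :: "inst \<Rightarrow> item \<Rightarrow> real" where
  "item_end I (Setup i a) = a + real (stime I i)"
| "item_end I (Piece j a l) = a + l"

definition makespan :: "inst \<Rightarrow> sched \<Rightarrow> real" where
  "makespan I S = Max (insert 0 (item_end I ` set (concat S)))"

definition OPT_split :: "inst \<Rightarrow> real" where
  "OPT_split I = Inf {makespan I S | S. feasible I S}"

text \<open>Machine configurations with multiplicities, and the schedule they represent.\<close>

type_synonym csched = "(nat \<times> item list) list"

definition expand :: "csched \<Rightarrow> sched" where
  "expand cs = concat (map (\<lambda>(k, M). replicate k M) cs)"

section \<open>The model of computation\<close>

text \<open>
  Running times refer to fixed while programs for a unit-cost RAM whose scalar registers and array
  cells hold real numbers. Arithmetic operations and comparisons are exact, only integer constants
  occur in programs. Array indices must be natural numbers at most \<open>W\<close>, and rounding is possible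
  only for values of modulus at most \<open>W\<close>; a program that violates this is stuck. With \<open>W\<close>
  polynomial in the size of the instance, the bound keeps rounding from being used to compute with
  very long integers in a single step, and it restricts addresses to logarithmically many bits.
  Every elementary command and every test costs 1; the expressions of a fixed program have constant
  size.
\<close>

datatype aexp = N int | V string
  | Plus aexp aexp | Minus aexp aexp | Times aexp aexp | Divide aexp aexp

datatype bexp = Less aexp aexp | Not bexp | And bexp bexp

datatype com =
    SKIP
  | Assign string aexp
  | Floor string aexp
  | Load string string aexp
  | Store string aexp aexp
  | Seq com com
  | If bexp com com
  | While bexp com

record state =
  reg :: "string \<Rightarrow> real"
  arr :: "string \<Rightarrow> nat \<Rightarrow> real"

fun aval :: "aexp \<Rightarrow> state \<Rightarrow> real" where
  "aval (N k) \<sigma> = of_int k"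
| "aval (V x) \<sigma> = reg \<sigma> x"
| "aval (Plus a b) \<sigma> = aval a \<sigma> + aval b \<sigma>"
| "aval (Minus a b) \<sigma> = aval a \<sigma> - aval b \<sigma>"
| "aval (Times a b) \<sigma> = aval a \<sigma> * aval b \<sigma>"
| "aval (Divide a b) \<sigma> = aval a \<sigma> / aval b \<sigma>"

fun bval :: "bexp \<Rightarrow> state \<Rightarrow> bool" where
  "bval (Less a b) \<sigma> \<longleftrightarrow> aval a \<sigma> < aval b \<sigma>"
| "bval (Not b) \<sigma> \<longleftrightarrow> \<not> bval b \<sigma>"
| "bval (And b b') \<sigma> \<longleftrightarrow> bval b \<sigma> \<and> bval b' \<sigma>"

definition set_reg :: "string \<Rightarrow> real \<Rightarrow> state \<Rightarrow> state" where
  "set_reg x v \<sigma> = \<sigma>\<lparr>reg := (reg \<sigma>)(x := v)\<rparr>"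

definition set_cell :: "string \<Rightarrow> nat \<Rightarrow> real \<Rightarrow> state \<Rightarrow> state" where
  "set_cell A i v \<sigma> = \<sigma>\<lparr>arr := (arr \<sigma>)(A := (arr \<sigma> A)(i := v))\<rparr>"

text \<open>\<open>exec W p \<sigma> k \<sigma>'\<close>: started in \<open>\<sigma>\<close>, \<open>p\<close> terminates in \<open>\<sigma>'\<close> after \<open>k\<close> steps.\<close>

inductive exec :: "nat \<Rightarrow> com \<Rightarrow> state \<Rightarrow> nat \<Rightarrow> state \<Rightarrow> bool" for W :: nat where
  Skip: "exec W SKIP \<sigma> 1 \<sigma>"
| Assign: "exec W (Assign x a) \<sigma> 1 (set_reg x (aval a \<sigma>) \<sigma>)"
| Floor: "\<bar>aval a \<sigma>\<bar> \<le> real W \<Longrightarrow>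
    exec W (Floor x a) \<sigma> 1 (set_reg x (of_int \<lfloor>aval a \<sigma>\<rfloor>) \<sigma>)"
| Load: "aval a \<sigma> = real i \<Longrightarrow> i \<le> W \<Longrightarrow>
    exec W (Load x A a) \<sigma> 1 (set_reg x (arr \<sigma> A i) \<sigma>)"
| Store: "aval a \<sigma> = real i \<Longrightarrow> i \<le> W \<Longrightarrow>
    exec W (Store A a b) \<sigma> 1 (set_cell A i (aval b \<sigma>) \<sigma>)"
| Seq: "exec W p \<sigma> k \<sigma>' \<Longrightarrow> exec W q \<sigma>' k' \<sigma>'' \<Longrightarrow> exec W (Seq p q) \<sigma> (k + k') \<sigma>''"
| IfTrue: "bval b \<sigma> \<Longrightarrow> exec W p \<sigma> k \<sigma>' \<Longrightarrow> exec W (If b p q) \<sigma> (1 + k) \<sigma>'"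
| IfFalse: "\<not> bval b \<sigma> \<Longrightarrow> exec W q \<sigma> k \<sigma>' \<Longrightarrow> exec W (If b p q) \<sigma> (1 + k) \<sigma>'"
| WhileFalse: "\<not> bval b \<sigma> \<Longrightarrow> exec W (While b p) \<sigma> 1 \<sigma>"
| WhileTrue: "bval b \<sigma> \<Longrightarrow> exec W p \<sigma> k \<sigma>' \<Longrightarrow> exec W (While b p) \<sigma>' k' \<sigma>'' \<Longrightarrow>
    exec W (While b p) \<sigma> (1 + k + k') \<sigma>''"

text \<open>The result and the running time of a program are unique, if it terminates without
  getting stuck.\<close>

lemma exec_deterministic:
  "exec W p \<sigma> k \<sigma>' \<Longrightarrow> exec W p \<sigma> l \<tau> \<Longrightarrow> l = k \<and> \<tau> = \<sigma>'"
proof (induction arbitrary: l \<tau> rule: exec.induct)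
  case (Seq p \<sigma> k \<sigma>' q k' \<sigma>'')
  from Seq.prems show ?case by (cases rule: exec.cases) (use Seq.IH in blast)+
next
  case (IfTrue b \<sigma> p k \<sigma>' q)
  from IfTrue.prems show ?case by (cases rule: exec.cases) (use IfTrue.IH IfTrue.hyps in blast)+
next
  case (IfFalse b \<sigma> q k \<sigma>' p)
  from IfFalse.prems show ?case by (cases rule: exec.cases) (use IfFalse.IH IfFalse.hyps in blast)+
next
  case (WhileTrue b \<sigma> p k \<sigma>' k' \<sigma>'')
  from WhileTrue.prems show ?case
    by (cases rule: exec.cases) (use WhileTrue.IH WhileTrue.hyps in blast)+
qed (erule exec.cases; auto)+

section \<open>Input and output\<close>

text \<open>Registers and cells that do not hold the input are \<open>0\<close> initially.\<close>

definition input_state :: "inst \<Rightarrow> real \<Rightarrow> state" where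
  "input_state I T =
    \<lparr> reg = (\<lambda>_. 0)(''m'' := real (machines I), ''n'' := real (jobs I),
                    ''c'' := real (classes I), ''T'' := T),
      arr = (\<lambda>_ _. 0)(''cls'' := (\<lambda>j. if j < jobs I then real (cls I j) else 0),
                      ''t'' := (\<lambda>j. if j < jobs I then real (ptime I j) else 0),
                      ''s'' := (\<lambda>i. if i < classes I then real (stime I i) else 0)) \<rparr>"

text \<open>
  A list of configurations with multiplicities is stored as follows: register \<open>groups\<close> holds its
  length, the arrays \<open>mult\<close> and \<open>len\<close> hold the multiplicity and the number of items of each
  configuration, and the items of all configurations are stored consecutively in the arrays
  \<open>kind\<close> (0 for setups, 1 for job pieces), \<open>id\<close>, \<open>start\<close> and (for pieces only) \<open>dur\<close>.
\<close>

fun holds_item :: "state \<Rightarrow> nat \<Rightarrow> item \<Rightarrow> bool" where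
  "holds_item \<sigma> p (Setup i a) \<longleftrightarrow>
     arr \<sigma> ''kind'' p = 0 \<and> arr \<sigma> ''id'' p = real i \<and> arr \<sigma> ''start'' p = a"
| "holds_item \<sigma> p (Piece j a l) \<longleftrightarrow>
     arr \<sigma> ''kind'' p = 1 \<and> arr \<sigma> ''id'' p = real j \<and> arr \<sigma> ''start'' p = a \<and>
     arr \<sigma> ''dur'' p = l"

definition outputs :: "state \<Rightarrow> csched \<Rightarrow> bool" where
  "outputs \<sigma> cs \<longleftrightarrow>
     reg \<sigma> ''groups'' = real (length cs) \<and>
     (\<forall>g < length cs. arr \<sigma> ''mult'' g = real (fst (cs ! g)) \<and>
                      arr \<sigma> ''len'' g = real (length (snd (cs ! g)))) \<and>
     (let its = concat (map snd cs) in \<forall>p < length its. holds_item \<sigma> p (its ! p))"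

end

theory Submission
  imports Defs
begin

text \<open>
  Lower bound: in a schedule of makespan \<open>B\<close> a machine can hold at most one setup of an expensive
  class, followed by less than \<open>B / 2\<close> of its load; so expensive class \<open>i\<close> needs \<open>beta I B i\<close>
  machines of its own, and summing up setups and loads gives \<open>L_split I B \<le> m B\<close>.

  Schedule: every expensive class is wrapped into machines with \<open>T / 2\<close> of load each. The load of the
  cheap classes forms one stream, which is wrapped into the space between \<open>T / 2\<close> above the top of the
  last machine of each expensive class and \<open>3 T / 2\<close>, and then into the intervals \<open>[T / 2, 3 T / 2]\<close>
  of the empty machines. As cheap setups have length at most \<open>T / 2\<close>, the class that continues on the
  next machine can be set up below the space used there. Every machine in use thereby accounts for
  \<open>T\<close> of \<open>L_split I T\<close>, so that the machines suffice. Machines filled by a single job are produced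
  with multiplicities, which leaves amortised constant work per job; the jobs of a class and the
  cheap classes are linked to lists instead of being sorted.
\<close>


section \<open>Lower bound\<close>

text \<open>Why \<open>T\<close> per machine can be charged: let class \<open>i\<close> occupy
  \<open>q \<le> beta_i\<close> machines, with \<open>sp\<close> of the last interval left free.
  Then \<open>q T / 2 \<le> P(C_i) + sp\<close>, and
  \<open>(q - 1) T / 2 \<le> (beta_i - 1) s_i\<close> because \<open>s_i > T / 2\<close>. Adding
  both gives \<open>q T - gap \<le> P(C_i) + beta_i s_i\<close> with
  \<open>gap = T / 2 - s_i + sp\<close>, and \<open>gap\<close> is exactly the space offered to
  cheap load on the last machine. If cheap load fills it, the deficit is covered; if
  \<open>gap \<le> 0\<close>, there is none. The deficit can remain only when the cheap load is
  exhausted, and then \<open>m_exp\<close> bounds the number of machines. So the two conditions on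
  \<open>m\<close> in (ii) serve two different cases. The hypothesis \<open>T \<ge> s_max\<close>
  keeps an expensive machine, of height \<open>s_i + T / 2\<close>, below \<open>3 T / 2\<close>.
  The hypothesis \<open>T \<ge> N / m\<close> is needed by the machine model: numbers of identical
  machines are found by rounding, which is allowed only up to \<open>W\<close>, and a job fills at
  most \<open>2 m\<close> intervals of length \<open>T / 2\<close>.\<close>

fun dur :: "inst \<Rightarrow> item \<Rightarrow> real" where
  "dur I (Setup i a) = real (stime I i)"
| "dur I (Piece j a l) = l"

fun is_setup :: "nat \<Rightarrow> item \<Rightarrow> bool" where
  "is_setup i (Setup i' a) \<longleftrightarrow> i' = i"
| "is_setup i (Piece j a l) \<longleftrightarrow> False"

definition setups :: "item list \<Rightarrow> nat \<Rightarrow> nat" where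
  "setups M i = length (filter (is_setup i) M)"

definition class_amount :: "inst \<Rightarrow> item list \<Rightarrow> nat \<Rightarrow> real" where
  "class_amount I M i = (\<Sum>j\<in>class_jobs I i. \<Sum>x\<leftarrow>M. amount j x)"

lemma setups_simps [simp]:
  "setups [] i = 0"
  "setups (Setup i' a # M) i = (if i' = i then 1 else 0) + setups M i"
  "setups (Piece j a l # M) i = setups M i"
  by (simp_all add: setups_def)

lemma finite_class_jobs [simp]: "finite (class_jobs I i)"
  by (simp add: class_jobs_def)

lemma class_amount_simps [simp]:
  "class_amount I [] i = 0"
  "class_amount I (Setup i' a # M) i = class_amount I M i"
  "class_amount I (Piece j a l # M) i = (if j \<in> class_jobs I i then l else 0) + class_amount I M i"
  by (simp_all add: class_amount_def sum.distrib)

lemma machine_ok_dur_le: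
  assumes "machine_ok I k x M" "\<forall>y\<in>set M. item_end I y \<le> B" "x \<le> B"
  shows "x + (\<Sum>y\<leftarrow>M. dur I y) \<le> B"
  using assms
proof (induction I k x M rule: machine_ok.induct)
  case (2 I k x i a M)
  then have "a + real (stime I i) + (\<Sum>y\<leftarrow>M. dur I y) \<le> B" by auto
  with 2 show ?case by auto
next
  case (3 I k x j a l M)
  then have "a + l + (\<Sum>y\<leftarrow>M. dur I y) \<le> B" by auto
  with 3 show ?case by auto
qed auto

lemma machine_ok_dur_eq:
  assumes "machine_ok I k x M" "\<forall>j<jobs I. cls I j < classes I"
  shows "(\<Sum>y\<leftarrow>M. dur I y) =
    (\<Sum>i<classes I. real (setups M i) * real (stime I i)) + (\<Sum>i<classes I. class_amount I M i)"
  using assms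
proof (induction I k x M rule: machine_ok.induct)
  case (2 I k x i a M)
  have "(\<Sum>i'<classes I. real (setups (Setup i a # M) i') * real (stime I i')) =
    (\<Sum>i'<classes I. (if i = i' then real (stime I i') else 0) + real (setups M i') * real (stime I i'))"
    by (intro sum.cong) (auto simp: algebra_simps)
  with 2 show ?case by (simp add: sum.distrib)
next
  case (3 I k x j a l M)
  have "(\<Sum>i<classes I. class_amount I (Piece j a l # M) i) =
    (\<Sum>i<classes I. (if cls I j = i then l else 0) + class_amount I M i)"
    using 3 by (intro sum.cong) (auto simp: class_jobs_def)
  also have "\<dots> = l + (\<Sum>i<classes I. class_amount I M i)"
    using 3 by (simp add: sum.distrib)
  finally show ?case using 3 by auto
qed auto

lemma class_amount_nonneg:
  "machine_ok I k x M \<Longrightarrow> 0 \<le> class_amount I M i"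
  by (induction I k x M rule: machine_ok.induct) auto

text \<open>Pieces are legal only while the machine is set up for their class, and that state stems
  from \<open>k\<close> or from an earlier \<open>Setup\<close>. Arbitrary \<open>k\<close> is for
  the induction; \<open>k = None\<close> is the case of interest.\<close>

lemma class_amount_no_setup:
  "machine_ok I k x M \<Longrightarrow> k \<noteq> Some i \<Longrightarrow> setups M i = 0 \<Longrightarrow> class_amount I M i = 0"
  by (induction I k x M rule: machine_ok.induct) (auto simp: class_jobs_def split: if_splits)

lemma item_end_le_makespan:
  "M \<in> set S \<Longrightarrow> y \<in> set M \<Longrightarrow> item_end I y \<le> makespan I S"
  unfolding makespan_def by (rule Max_ge) auto

lemma sum_sum_list_swap:
  "(\<Sum>i\<in>A. \<Sum>x\<leftarrow>xs. f i x) = (\<Sum>x\<leftarrow>xs. \<Sum>i\<in>A. f i x :: 'a :: comm_monoid_add)"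
  by (induction xs) (simp_all add: sum.distrib)

lemma sum_list_le_length:
  fixes f :: "'a \<Rightarrow> real"
  assumes "\<And>x. x \<in> set xs \<Longrightarrow> f x \<le> c"
  shows "(\<Sum>x\<leftarrow>xs. f x) \<le> real (length xs) * c"
  using assms
proof (induction xs)
  case (Cons x xs)
  then have "f x \<le> c" "(\<Sum>x\<leftarrow>xs. f x) \<le> real (length xs) * c" by auto
  then show ?case by (simp add: algebra_simps)
qed auto

lemma sum_classes:
  assumes "\<forall>j<jobs I. cls I j < classes I"
  shows "(\<Sum>i<classes I. \<Sum>j\<in>class_jobs I i. f j) = (\<Sum>j<jobs I. f j :: 'a :: comm_monoid_add)"
proof -
  have "(\<Sum>j<jobs I. f j) = (\<Sum>i<classes I. \<Sum>j\<in>{j\<in>{..<jobs I}. cls I j = i}. f j)"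
    by (rule sum.group[symmetric]) (use assms in auto)
  then show ?thesis by (simp add: class_jobs_def)
qed

lemma split_classes:
  "(\<Sum>i<classes I. f i) = (\<Sum>i\<in>I_chp I B. f i) + (\<Sum>i\<in>I_exp I B. f i :: 'a :: comm_monoid_add)"
proof -
  have "{..<classes I} = I_chp I B \<union> I_exp I B" "I_chp I B \<inter> I_exp I B = {}"
    "finite (I_chp I B)" "finite (I_exp I B)"
    by (auto simp: I_chp_def I_exp_def)
  then show ?thesis by (simp add: sum.union_disjoint)
qed

text \<open>Everything is read off the numbers \<open>tot i\<close> of setups: they are at least
  \<open>beta I B i\<close> for expensive and at least 1 for cheap classes. At most one expensive
  setup per machine gives the first bound; adding up the busy times of all machines gives the
  second.\<close>

lemma schedule_bounds:
  assumes wf: "wf_inst I" and feas: "feasible I S" and ms: "makespan I S \<le> B" and B: "0 < B"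
  shows "m_exp I B \<le> int (machines I)" "real_of_int (L_split I B) \<le> real (machines I) * B"
proof -
  define tot where "tot i = (\<Sum>M\<leftarrow>S. setups M i)" for i
  have cl: "\<forall>j<jobs I. cls I j < classes I" using wf by (auto simp: wf_inst_def)
  have len: "length S = machines I" using feas by (simp add: feasible_def)
  have ok: "machine_ok I None 0 M" if "M \<in> set S" for M using feas that by (simp add: feasible_def)
  have le: "(\<Sum>i<classes I. real (setups M i) * real (stime I i)) + (\<Sum>i<classes I. class_amount I M i) \<le> B"
    if "M \<in> set S" for M
  proof -
    have "0 + (\<Sum>y\<leftarrow>M. dur I y) \<le> B"
      using item_end_le_makespan[OF that, of _ I] ms B
      by (intro machine_ok_dur_le[OF ok[OF that]]) fastforce+
    then show ?thesis using machine_ok_dur_eq[OF ok[OF that] cl] by simp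
  qed
  have one: "real (setups M i) * real (stime I i) + class_amount I M i \<le> B"
    if "M \<in> set S" "i < classes I" for M i
  proof -
    have "real (setups M i) * real (stime I i) \<le> (\<Sum>i<classes I. real (setups M i) * real (stime I i))"
      using that by (intro member_le_sum) auto
    moreover have "class_amount I M i \<le> (\<Sum>i<classes I. class_amount I M i)"
      using that class_amount_nonneg[OF ok] by (intro member_le_sum) auto
    ultimately show ?thesis using le[OF that(1)] by linarith
  qed
  have am: "(\<Sum>M\<leftarrow>S. class_amount I M i) = real (load I (class_jobs I i))" for i
  proof -
    have "(\<Sum>M\<leftarrow>S. class_amount I M i) = (\<Sum>j\<in>class_jobs I i. \<Sum>M\<leftarrow>S. \<Sum>x\<leftarrow>M. amount j x)"
      unfolding class_amount_def by (rule sum_sum_list_swap[symmetric])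
    also have "\<dots> = (\<Sum>j\<in>class_jobs I i. real (ptime I j))"
      using feas by (intro sum.cong) (auto simp: feasible_def class_jobs_def)
    finally show ?thesis by (simp add: load_def)
  qed
  have rtot: "real (tot i) = (\<Sum>M\<leftarrow>S. real (setups M i))" for i
    unfolding tot_def by (induction S) auto
  have lpos: "0 < load I (class_jobs I i)" if i: "i < classes I" for i
  proof -
    obtain j where "j \<in> class_jobs I i" using wf i by (auto simp: wf_inst_def)
    then show ?thesis using wf unfolding load_def
      by (intro sum_pos2[of _ j]) (auto simp: wf_inst_def class_jobs_def)
  qed
  \<comment> \<open>The class has positive load, and load without a setup is impossible. Positive
    processing times enter here.\<close>
  have chp: "1 \<le> tot i" if "i < classes I" for i
  proof (rule ccontr)
    assume "\<not> 1 \<le> tot i"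
    then have "(\<Sum>M\<leftarrow>S. setups M i) = 0" by (simp add: tot_def not_less_eq_eq)
    then have "\<forall>M\<in>set S. setups M i = 0" by simp
    then have "\<forall>M\<in>set S. class_amount I M i = 0" using ok class_amount_no_setup by blast
    then have "(\<Sum>M\<leftarrow>S. class_amount I M i) = 0" by (induction S) auto
    with am lpos[OF that] show False by simp
  qed
  have exp: "beta I B i \<le> int (tot i)" if "i \<in> I_exp I B" for i
  proof -
    have i: "i < classes I" "B / 2 < real (stime I i)" using that by (auto simp: I_exp_def)
    \<comment> \<open>The first setup alone leaves at most \<open>B / 2\<close> for load, and
      further ones only raise the right-hand side; uniqueness of expensive setups is not
      presupposed.\<close>
    have *: "class_amount I M i \<le> B / 2 * real (setups M i)" if M: "M \<in> set S" for M
    proof (cases "setups M i = 0")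
      case True
      then show ?thesis using class_amount_no_setup[OF ok[OF M]] by simp
    next
      case False
      then have "1 \<le> real (setups M i)" by simp
      then have "B / 2 * 1 \<le> B / 2 * real (setups M i)" "1 * real (stime I i) \<le> real (setups M i) * real (stime I i)"
        using B by (auto intro!: mult_left_mono mult_right_mono simp del: mult_1)
      with one[OF M i(1)] i(2) show ?thesis by linarith
    qed
    have "(\<Sum>M\<leftarrow>S. class_amount I M i) \<le> (\<Sum>M\<leftarrow>S. B / 2 * real (setups M i))"
      using * by (intro sum_list_mono) auto
    then have "real (load I (class_jobs I i)) \<le> B / 2 * real (tot i)"
      unfolding am rtot by (subst (asm) sum_list_const_mult)
    then have "2 * real (load I (class_jobs I i)) / B \<le> real (tot i)"
      using B by (simp add: field_simps)
    then show ?thesis unfolding beta_def by (simp add: ceiling_le_iff)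
  qed
  have fin: "finite (I_exp I B)" by (simp add: I_exp_def)
  \<comment> \<open>Each of these setups is longer than \<open>B / 2\<close>, so two of them exceed
    \<open>B\<close>. Strictness of the sum requires an \<open>i0\<close> that really
    occurs.\<close>
  have single: "real (\<Sum>i\<in>I_exp I B. setups M i) \<le> 1" if M: "M \<in> set S" for M
  proof (rule ccontr)
    assume "\<not> ?thesis"
    then have "2 \<le> (\<Sum>i\<in>I_exp I B. setups M i)" by (simp del: of_nat_sum)
    then have two: "2 \<le> real (\<Sum>i\<in>I_exp I B. setups M i)" by (simp del: of_nat_sum)
    have "\<exists>i\<in>I_exp I B. 0 < setups M i"
    proof (rule ccontr)
      assume "\<not> ?thesis"
      then have "(\<Sum>i\<in>I_exp I B. setups M i) = 0" by auto
      with two show False by simp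
    qed
    then obtain i0 where i0: "i0 \<in> I_exp I B" "0 < setups M i0" by blast
    have "B / 2 * real (\<Sum>i\<in>I_exp I B. setups M i) = (\<Sum>i\<in>I_exp I B. real (setups M i) * (B / 2))"
      by (simp add: sum_distrib_left mult.commute)
    also have "\<dots> < (\<Sum>i\<in>I_exp I B. real (setups M i) * real (stime I i))"
    proof (rule sum_strict_mono_ex1[OF fin])
      show "\<forall>i\<in>I_exp I B. real (setups M i) * (B / 2) \<le> real (setups M i) * real (stime I i)"
        unfolding I_exp_def by (intro ballI mult_left_mono) auto
      show "\<exists>i\<in>I_exp I B. real (setups M i) * (B / 2) < real (setups M i) * real (stime I i)"
        using i0 unfolding I_exp_def by (intro bexI[of _ i0] mult_strict_left_mono) auto
    qed
    also have "\<dots> \<le> (\<Sum>i<classes I. real (setups M i) * real (stime I i))"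
      by (intro sum_mono2) (auto simp: I_exp_def)
    also have "\<dots> \<le> B"
    proof -
      have "0 \<le> (\<Sum>i<classes I. class_amount I M i)"
        by (intro sum_nonneg class_amount_nonneg[OF ok[OF M]])
      with le[OF M] show ?thesis by linarith
    qed
    finally show False using mult_left_mono[OF two, of "B / 2"] B by linarith
  qed
  have "real (\<Sum>i\<in>I_exp I B. tot i) = (\<Sum>M\<leftarrow>S. real (\<Sum>i\<in>I_exp I B. setups M i))"
    unfolding of_nat_sum rtot by (rule sum_sum_list_swap)
  also have "\<dots> \<le> real (length S) * 1"
    using single by (intro sum_list_le_length)
  finally have "(\<Sum>i\<in>I_exp I B. tot i) \<le> machines I" by (simp add: len flip: of_nat_sum)
  moreover have "m_exp I B \<le> int (\<Sum>i\<in>I_exp I B. tot i)"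
    unfolding m_exp_def of_nat_sum by (intro sum_mono exp)
  ultimately show "m_exp I B \<le> int (machines I)" by linarith
  have "(\<Sum>i\<in>I_chp I B. int (stime I i)) + (\<Sum>i\<in>I_exp I B. beta I B i * int (stime I i))
      \<le> (\<Sum>i\<in>I_chp I B. int (tot i) * int (stime I i)) + (\<Sum>i\<in>I_exp I B. int (tot i) * int (stime I i))"
  proof (intro add_mono sum_mono)
    fix i assume "i \<in> I_chp I B"
    then have "1 * int (stime I i) \<le> int (tot i) * int (stime I i)"
      using chp[of i] by (intro mult_right_mono) (auto simp: I_chp_def)
    then show "int (stime I i) \<le> int (tot i) * int (stime I i)" by simp
  qed (auto intro!: mult_right_mono exp)
  also have "\<dots> = (\<Sum>i<classes I. int (tot i) * int (stime I i))" by (simp add: split_classes[of _ I B])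
  finally have "L_split I B \<le> int (load I {..<jobs I}) + (\<Sum>i<classes I. int (tot i) * int (stime I i))"
    by (simp add: L_split_def)
  then have "real_of_int (L_split I B) \<le>
      real_of_int (int (load I {..<jobs I}) + (\<Sum>i<classes I. int (tot i) * int (stime I i)))"
    by (rule of_int_le_iff[THEN iffD2])
  also have "\<dots> = real (load I {..<jobs I}) + (\<Sum>i<classes I. real (tot i) * real (stime I i))"
    by simp
  also have "real (load I {..<jobs I}) = (\<Sum>i<classes I. \<Sum>M\<leftarrow>S. class_amount I M i)"
    unfolding am load_def of_nat_sum by (simp add: sum_classes[OF cl])
  also have "\<dots> = (\<Sum>M\<leftarrow>S. \<Sum>i<classes I. class_amount I M i)" by (rule sum_sum_list_swap)
  also have "(\<Sum>i<classes I. real (tot i) * real (stime I i))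
      = (\<Sum>i<classes I. \<Sum>M\<leftarrow>S. real (setups M i) * real (stime I i))"
    by (simp add: rtot sum_list_mult_const)
  also have "\<dots> = (\<Sum>M\<leftarrow>S. \<Sum>i<classes I. real (setups M i) * real (stime I i))"
    by (rule sum_sum_list_swap)
  also have "(\<Sum>M\<leftarrow>S. \<Sum>i<classes I. class_amount I M i) + \<dots>
    = (\<Sum>M\<leftarrow>S. (\<Sum>i<classes I. class_amount I M i) + (\<Sum>i<classes I. real (setups M i) * real (stime I i)))"
    by (simp add: sum_list_addf)
  also have "\<dots> \<le> real (length S) * B" using le by (intro sum_list_le_length) (simp add: add.commute)
  finally show "real_of_int (L_split I B) \<le> real (machines I) * B" by (simp add: len)
qed

text \<open>\<open>beta\<close>, \<open>L_split\<close> and \<open>m_exp\<close> are locally constant to the right of any \<open>T > 0\<close>, which turns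
  the lower bounds for single schedules into a strict one for the infimum.\<close>

lemma eventually_beta_right:
  assumes "0 < T"
  shows "eventually (\<lambda>B. beta I B i = beta I T i) (at_right T)"
proof -
  let ?p = "2 * real (load I (class_jobs I i))"
  have "((\<lambda>B. ?p / B) \<longlongrightarrow> ?p / T) (at_right T)"
    using assms by (auto intro!: tendsto_eq_intros)
  \<comment> \<open>The quotient decreases as \<open>B\<close> grows, so the ceiling could only
    drop. For that the quotient must reach the integer \<open>\<lceil>?p / T\<rceil> - 1\<close>,
    which lies strictly below its limit.\<close>
  moreover have "real_of_int (\<lceil>?p / T\<rceil> - 1) < ?p / T" by linarith
  ultimately have "eventually (\<lambda>B. real_of_int (\<lceil>?p / T\<rceil> - 1) < ?p / B) (at_right T)"
    by (rule order_tendstoD(1))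
  moreover have "eventually (\<lambda>B. T < B) (at_right T)" by (rule eventually_at_right_less)
  ultimately show ?thesis
  proof eventually_elim
    case (elim B)
    then have "?p / B \<le> ?p / T" using assms by (intro divide_left_mono) auto
    with elim(1) show ?case unfolding beta_def by linarith
  qed
qed

text \<open>The defining condition is strict, so it survives a small increase of \<open>B\<close>,
  while its negation survives every increase.\<close>

lemma eventually_I_exp_right: "eventually (\<lambda>B. I_exp I B = I_exp I T) (at_right T)"
proof -
  have "eventually (\<lambda>B. (B / 2 < real (stime I i)) = (T / 2 < real (stime I i))) (at_right T)" for i
  proof (cases "T / 2 < real (stime I i)")
    case True
    have "((\<lambda>B. B / 2) \<longlongrightarrow> T / 2) (at_right T)" by (auto intro!: tendsto_eq_intros)
    from order_tendstoD(2)[OF this True] show ?thesis by eventually_elim (use True in simp)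
  next
    case False
    have "eventually (\<lambda>B. T < B) (at_right T)" by (rule eventually_at_right_less)
    then show ?thesis by eventually_elim (use False in simp)
  qed
  then have "eventually (\<lambda>B. \<forall>i\<in>{..<classes I}. (B / 2 < real (stime I i)) = (T / 2 < real (stime I i)))
      (at_right T)"
    by (intro eventually_ball_finite) auto
  then show ?thesis by eventually_elim (auto simp: I_exp_def)
qed

lemma OPT_split_gt:
  assumes wf: "wf_inst I" and T: "0 < T" and ex: "\<exists>S. feasible I S"
    and bad: "real (machines I) * T < real_of_int (L_split I T) \<or> int (machines I) < m_exp I T"
  shows "T < OPT_split I"
proof (rule ccontr)
  assume opt: "\<not> T < OPT_split I"
  \<comment> \<open>The infimum is not shown to be attained, so schedules are available only for
    each \<open>B > T\<close>; \<open>ex\<close> supplies the nonempty set that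
    \<open>cInf_lessD\<close> asks for.\<close>
  have ub: "\<exists>S. feasible I S \<and> makespan I S \<le> B" if "T < B" for B
  proof -
    have "Inf {makespan I S | S. feasible I S} < B" using opt that by (simp add: OPT_split_def)
    from cInf_lessD[OF _ this] ex show ?thesis by (auto intro: less_imp_le)
  qed
  have ev: "eventually (\<lambda>B. T < B) (at_right T)" by (rule eventually_at_right_less)
  have "eventually (\<lambda>B. \<forall>i\<in>{..<classes I}. beta I B i = beta I T i) (at_right T)"
    using eventually_beta_right[OF T] by (intro eventually_ball_finite) auto
  with eventually_I_exp_right[of I T] ev
  have *: "eventually (\<lambda>B. m_exp I T \<le> int (machines I) \<and> real_of_int (L_split I T) \<le> real (machines I) * B) (at_right T)"
  proof eventually_elim
    case (elim B)
    have chp: "I_chp I B = I_chp I T"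
      using elim(1) by (force simp: I_chp_def I_exp_def set_eq_iff not_less[symmetric])
    have "(\<Sum>i\<in>I_exp I T. beta I B i) = (\<Sum>i\<in>I_exp I T. beta I T i)"
      "(\<Sum>i\<in>I_exp I T. beta I B i * int (stime I i)) = (\<Sum>i\<in>I_exp I T. beta I T i * int (stime I i))"
      using elim(3) by (auto simp: I_exp_def intro!: sum.cong)
    then have "m_exp I B = m_exp I T" "L_split I B = L_split I T"
      by (simp_all add: m_exp_def L_split_def elim(1) chp)
    moreover obtain S where "feasible I S" "makespan I S \<le> B" using ub elim(2) by blast
    ultimately show ?case using schedule_bounds[OF wf, of S B] elim(2) T by simp
  qed
  have "((\<lambda>B. real (machines I) * B) \<longlongrightarrow> real (machines I) * T) (at_right T)"
    by (auto intro!: tendsto_eq_intros)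
  then have "real_of_int (L_split I T) \<le> real (machines I) * T"
    by (rule tendsto_lowerbound) (use * in \<open>auto elim: eventually_mono\<close>)
  moreover have "m_exp I T \<le> int (machines I)"
    using eventually_happens[OF *] by auto
  ultimately show False using bad by linarith
qed

section \<open>Wrapping\<close>

text \<open>
  A stream is a list of jobs with remaining processing times. \<open>fill I E sp xs\<close> wraps a prefix of
  the stream \<open>xs\<close> into the interval \<open>[E - sp, E]\<close> of a machine that is already set up for the first
  class of \<open>xs\<close>; it returns the items, the space that is left and the remaining stream. If the
  remaining stream is nonempty, the space left is useless: a split job or the setup that did not
  fit continues on the next machine, with its setup below the interval used there.
\<close>

fun fill :: "inst \<Rightarrow> real \<Rightarrow> real \<Rightarrow> (nat \<times> real) list \<Rightarrow> item list \<times> real \<times> (nat \<times> real) list" where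
  "fill I E sp [] = ([], sp, [])"
| "fill I E sp [(j, r)] =
     (if sp < r then ([Piece j (E - sp) sp], 0, [(j, r - sp)]) else ([Piece j (E - sp) r], sp - r, []))"
| "fill I E sp ((j, r) # (j', r') # xs) =
     (if sp < r then ([Piece j (E - sp) sp], 0, (j, r - sp) # (j', r') # xs)
      else if cls I j' = cls I j
      then apfst ((#) (Piece j (E - sp) r)) (fill I E (sp - r) ((j', r') # xs))
      else if sp - r < real (stime I (cls I j')) then ([Piece j (E - sp) r], sp - r, (j', r') # xs)
      else apfst (\<lambda>its. Piece j (E - sp) r # Setup (cls I j') (E - (sp - r)) # its)
             (fill I E (sp - r - real (stime I (cls I j'))) ((j', r') # xs)))"

text \<open>The setup of the first class is free, as it is placed below the interval to be filled.\<close>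

fun need :: "inst \<Rightarrow> (nat \<times> real) list \<Rightarrow> real" where
  "need I [] = 0"
| "need I [(j, r)] = r"
| "need I ((j, r) # (j', r') # xs) =
     r + (if cls I j' = cls I j then 0 else real (stime I (cls I j'))) + need I ((j', r') # xs)"

text \<open>Positive \<open>r\<close> makes the number \<open>\<lceil>r / cap\<rceil> - 1\<close> of
  full copies a natural number; \<open>r \<le> real (ptime I j)\<close> keeps the rounded quotient
  within \<open>W\<close>.\<close>

definition valid :: "inst \<Rightarrow> (nat \<times> real) list \<Rightarrow> bool" where
  "valid I xs \<longleftrightarrow> (\<forall>(j, r)\<in>set xs. j < jobs I \<and> 0 < r \<and> r \<le> real (ptime I j))"

definition remain :: "(nat \<times> real) list \<Rightarrow> nat \<Rightarrow> real" where
  "remain xs j = (\<Sum>(j', r)\<leftarrow>xs. if j' = j then r else 0)"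

definition amounts :: "item list \<Rightarrow> nat \<Rightarrow> real" where
  "amounts M j = (\<Sum>x\<leftarrow>M. amount j x)"

lemma valid_simps [simp]:
  "valid I []"
  "valid I ((j, r) # xs) \<longleftrightarrow> j < jobs I \<and> 0 < r \<and> r \<le> real (ptime I j) \<and> valid I xs"
  by (auto simp: valid_def)

lemma remain_simps [simp]:
  "remain [] j = 0"
  "remain ((j', r) # xs) j = (if j' = j then r else 0) + remain xs j"
  by (simp_all add: remain_def)

lemma amounts_simps [simp]:
  "amounts [] j = 0"
  "amounts (x # M) j = amount j x + amounts M j"
  "amounts (M @ M') j = amounts M j + amounts M' j"
  by (simp_all add: amounts_def)

lemma need_reduce: "need I ((j, r - d) # xs) = need I ((j, r) # xs) - d"
  by (cases xs) auto

lemma fill_space: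
  assumes "valid I xs" "0 \<le> sp"
  shows "0 \<le> fst (snd (fill I E sp xs)) \<and> fst (snd (fill I E sp xs)) \<le> sp"
  using assms
proof (induction I E sp xs rule: fill.induct)
  case (3 I E sp j r j' r' xs)
  then show ?case by (auto simp: not_less)
qed auto

text \<open>Gives \<open>sp < cap\<close> in \<open>block\<close>: the last interval is never left
  entirely empty, so the number of machines is bounded by a ceiling rather than by one more.\<close>

lemma fill_space_first:
  assumes "valid I xs" "0 \<le> sp" "xs \<noteq> []" "snd (hd xs) \<le> sp"
  shows "fst (snd (fill I E sp xs)) \<le> sp - snd (hd xs)"
  using assms
proof (cases "(I, E, sp, xs)" rule: fill.cases)
  case (3 I E sp j r j' r' xs)
  with assms fill_space[of I "(j', r') # xs" "sp - r" E]
    fill_space[of I "(j', r') # xs" "sp - r - real (stime I (cls I j'))" E]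
  show ?thesis by auto
qed auto

lemma fill_rest_le: "length (snd (snd (fill I E sp xs))) \<le> length xs"
  by (induction I E sp xs rule: fill.induct) auto

text \<open>A head that fits is finished here. Termination and amortised time of the wrapping loop
  rest on this.\<close>

lemma fill_rest_less:
  assumes "xs \<noteq> []" "snd (hd xs) \<le> sp"
  shows "length (snd (snd (fill I E sp xs))) < length xs"
proof (cases "(I, E, sp, xs)" rule: fill.cases)
  case (3 I E sp j r j' r' xs)
  with assms fill_rest_le[of I E "sp - r" "(j', r') # xs"]
    fill_rest_le[of I E "sp - r - real (stime I (cls I j'))" "(j', r') # xs"]
  show ?thesis by auto
qed (use assms in auto)

lemma fill_valid:
  "valid I xs \<Longrightarrow> 0 \<le> sp \<Longrightarrow> valid I (snd (snd (fill I E sp xs)))"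
  by (induction I E sp xs rule: fill.induct) auto

lemma fill_jobs: "x \<in> set (snd (snd (fill I E sp xs))) \<Longrightarrow> fst x \<in> fst ` set xs"
  by (induction I E sp xs rule: fill.induct) (auto split: if_splits)

lemma fill_amounts:
  "amounts (fst (fill I E sp xs)) i + remain (snd (snd (fill I E sp xs))) i = remain xs i"
proof (induction I E sp xs rule: fill.induct)
  case (3 I E sp j r j' r' xs)
  show ?case
  proof (cases "sp < r \<or> cls I j' \<noteq> cls I j \<and> sp - r < real (stime I (cls I j'))")
    case True
    then show ?thesis by auto
  next
    case False
    then show ?thesis using 3 by (cases "cls I j' = cls I j") (simp_all add: add.assoc)
  qed
qed auto

lemma fill_item_end:
  assumes "valid I xs" "0 \<le> sp" "y \<in> set (fst (fill I E sp xs))"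
  shows "item_end I y \<le> E - fst (snd (fill I E sp xs))"
  using assms
proof (induction I E sp xs rule: fill.induct)
  case (3 I E sp j r j' r' xs)
  with fill_space[of I "(j', r') # xs" "sp - r" E]
    fill_space[of I "(j', r') # xs" "sp - r - real (stime I (cls I j'))" E]
  show ?case by (auto split: if_splits)
qed (auto split: if_splits)

lemma fill_machine_ok:
  assumes "valid I xs" "0 \<le> sp" "\<forall>j<jobs I. cls I j < classes I" "xs \<noteq> []" "x \<le> E - sp"
  shows "machine_ok I (Some (cls I (fst (hd xs)))) x (fst (fill I E sp xs))"
  using assms
proof (induction I E sp xs arbitrary: x rule: fill.induct)
  case (3 I E sp j r j' r' xs)
  show ?case
  proof (cases "cls I j' = cls I j")
    case True
    with 3 show ?thesis by auto
  next
    case False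
    with 3 show ?thesis by auto
  qed
qed auto

text \<open>If load remains, the interval has been paid for completely. A split job fills it to the
  end; otherwise the wasted space is shorter than the setup that did not fit, and this setup leaves
  \<open>need\<close> because it becomes the free first setup of the next machine.\<close>

lemma fill_need:
  assumes "valid I xs" "0 \<le> sp"
  shows "snd (snd (fill I E sp xs)) \<noteq> [] \<Longrightarrow> need I (snd (snd (fill I E sp xs))) + sp \<le> need I xs"
    and "snd (snd (fill I E sp xs)) = [] \<Longrightarrow> sp \<le> need I xs + fst (snd (fill I E sp xs))"
  using assms
proof (induction I E sp xs rule: fill.induct)
  case (3 I E sp j r j' r' xs)
  { case 1 with 3 show ?case by (auto simp: need_reduce not_less) }
  { case 2 with 3 show ?case by (auto simp: not_less split: if_splits) }
qed (auto split: if_splits)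

text \<open>Quantifying over \<open>k'\<close> avoids tracking the setup state at the end of
  \<open>M\<close>; this is affordable because the appended part begins with a
  \<open>Setup\<close>.\<close>

lemma machine_ok_append:
  assumes "machine_ok I k x M" "\<forall>y\<in>set M. item_end I y \<le> a" "x \<le> a"
    "\<And>k'. machine_ok I k' a M'"
  shows "machine_ok I k x (M @ M')"
  using assms
proof (induction I k x M rule: machine_ok.induct)
  case (1 I k x)
  moreover have "machine_ok I k y N \<Longrightarrow> x \<le> y \<Longrightarrow> machine_ok I k x N" for y N
    by (cases "(I, k, y, N)" rule: machine_ok.cases) auto
  ultimately show ?case by auto
qed auto

text \<open>\<open>M = []\<close> with \<open>a = 0\<close> is a fresh machine. For the last machine
  of an expensive class, \<open>a\<close> is its top, and the setup has to fit between
  \<open>a\<close> and the interval.\<close>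

lemma filled_machine:
  assumes "valid I xs" "0 \<le> sp" "\<forall>j<jobs I. cls I j < classes I" "xs \<noteq> []"
    and "\<forall>y\<in>set M. item_end I y \<le> a" "machine_ok I None 0 M" "0 \<le> a"
    and "real (stime I (cls I (fst (hd xs)))) \<le> E - sp - a"
  defines "M' \<equiv> M @ Setup (cls I (fst (hd xs))) (E - sp - real (stime I (cls I (fst (hd xs))))) # fst (fill I E sp xs)"
  shows "machine_ok I None 0 M'" "\<forall>y\<in>set M'. item_end I y \<le> E - fst (snd (fill I E sp xs))"
proof -
  obtain j r xs' where xs: "xs = (j, r) # xs'" using assms by (cases xs) auto
  then have "cls I (fst (hd xs)) < classes I" using assms by auto
  then show "machine_ok I None 0 M'"
    unfolding M'_def using assms fill_machine_ok[of I xs sp "E - sp"]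
    by (intro machine_ok_append[of _ _ _ _ a]) auto
  show "\<forall>y\<in>set M'. item_end I y \<le> E - fst (snd (fill I E sp xs))"
    using assms fill_item_end[of I xs sp _ E] fill_space[of I xs sp E] by fastforce
qed

section \<open>Blocks\<close>

definition count :: "csched \<Rightarrow> nat" where
  "count cs = (\<Sum>(k, M)\<leftarrow>cs. k)"

definition camounts :: "csched \<Rightarrow> nat \<Rightarrow> real" where
  "camounts cs j = (\<Sum>(k, M)\<leftarrow>cs. real k * amounts M j)"

definition cok :: "inst \<Rightarrow> real \<Rightarrow> csched \<Rightarrow> bool" where
  "cok I B cs \<longleftrightarrow> (\<forall>(k, M)\<in>set cs. machine_ok I None 0 M \<and> (\<forall>y\<in>set M. item_end I y \<le> B))"

lemma count_simps [simp]:
  "count [] = 0" "count ((k, M) # cs) = k + count cs" "count (cs @ cs') = count cs + count cs'"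
  by (simp_all add: count_def)

lemma camounts_simps [simp]:
  "camounts [] j = 0" "camounts ((k, M) # cs) j = real k * amounts M j + camounts cs j"
  "camounts (cs @ cs') j = camounts cs j + camounts cs' j"
  by (simp_all add: camounts_def)

lemma cok_simps [simp]:
  "cok I B []"
  "cok I B ((k, M) # cs) \<longleftrightarrow> machine_ok I None 0 M \<and> (\<forall>y\<in>set M. item_end I y \<le> B) \<and> cok I B cs"
  "cok I B (cs @ cs') \<longleftrightarrow> cok I B cs \<and> cok I B cs'"
  by (auto simp: cok_def)

lemma cok_mono: "cok I B cs \<Longrightarrow> B \<le> B' \<Longrightarrow> cok I B' cs"
  by (fastforce simp: cok_def)

text \<open>\<open>block I E cap xs0 gs xs sp\<close>: the stream \<open>xs0\<close> has been wrapped into the intervals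
  \<open>[E - cap, E]\<close> of the machines \<open>gs\<close> up to \<open>xs\<close>; \<open>sp\<close> is the space left on the last machine.\<close>

definition block :: "inst \<Rightarrow> real \<Rightarrow> real \<Rightarrow> (nat \<times> real) list \<Rightarrow> csched \<Rightarrow> (nat \<times> real) list \<Rightarrow> real \<Rightarrow> bool" where
  "block I E cap xs0 gs xs sp \<longleftrightarrow>
     cok I E gs \<and> (\<forall>j. camounts gs j + remain xs j = remain xs0 j) \<and>
     valid I xs \<and> fst ` set xs \<subseteq> fst ` set xs0 \<and>
     (if xs = [] then \<exists>gs' M. gs = gs' @ [(1, M)] \<and> (\<forall>y\<in>set M. item_end I y \<le> E - sp) \<and>
        0 \<le> sp \<and> sp < cap \<and> real (count gs) * cap \<le> need I xs0 + sp
      else need I xs + real (count gs) * cap \<le> need I xs0)"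

lemma block_init: "valid I xs \<Longrightarrow> xs \<noteq> [] \<Longrightarrow> block I E cap xs [] xs sp"
  by (simp add: block_def)

text \<open>Splitting off \<open>\<lceil>r / cap\<rceil> - 1\<close> full copies leaves a remainder
  in \<open>(0, cap]\<close>, which the next interval finishes, so a job leaves the stream in every
  step. A group of multiplicity \<open>k = 0\<close> is harmless and spares a case
  distinction.\<close>

lemma block_step:
  assumes blk: "block I E cap xs0 gs ((j, r) # xs) sp" and cap: "0 < cap"
    and cl: "\<forall>j<jobs I. cls I j < classes I"
    and fits: "\<forall>x\<in>set xs0. real (stime I (cls I (fst x))) \<le> E - cap"
    and k: "int k = \<lceil>r / cap\<rceil> - 1"
  defines "su \<equiv> Setup (cls I j) (E - cap - real (stime I (cls I j)))"
    and "ys \<equiv> (j, r - real k * cap) # xs"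
  defines "F \<equiv> fill I E cap ys"
  defines "gs' \<equiv> gs @ [(k, [su, Piece j (E - cap) cap]), (1, su # fst F)]"
  shows "block I E cap xs0 gs' (snd (snd F)) (fst (snd F))"
    and "length (snd (snd F)) < length ((j, r) # xs)"
    and "0 < r - real k * cap" "r - real k * cap \<le> cap"
proof -
  have kr: "real k = real_of_int \<lceil>r / cap\<rceil> - 1" using k by linarith
  have "real k < r / cap" "r / cap \<le> real k + 1" using kr by linarith+
  then show r': "0 < r - real k * cap" "r - real k * cap \<le> cap"
    using cap by (simp_all add: field_simps)
  have val: "valid I ((j, r) # xs)" and sub: "fst ` set ((j, r) # xs) \<subseteq> fst ` set xs0"
    using blk by (auto simp: block_def)
  have "0 \<le> real k * cap" using cap by simp
  with val have "r - real k * cap \<le> real (ptime I j)" unfolding valid_simps by linarith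
  then have ys: "valid I ys" using val r' by (simp add: ys_def)
  have st: "real (stime I (cls I j)) \<le> E - cap"
    using fits sub by auto
  have cj: "cls I j < classes I" "j < jobs I" using cl val by auto
  show "length (snd (snd F)) < length ((j, r) # xs)"
    using fill_rest_less[of ys cap I E] r' by (simp add: F_def ys_def)
  have m: "machine_ok I None 0 (su # fst F)" "\<forall>y\<in>set (su # fst F). item_end I y \<le> E - fst (snd F)"
    using filled_machine[of I ys cap "[]" 0 E] ys cap cl st
    by (auto simp: su_def F_def ys_def)
  have sp: "0 \<le> fst (snd F)" "fst (snd F) < cap"
    using fill_space[OF ys, of cap E] fill_space_first[OF ys, of cap E] r' cap
    by (auto simp: F_def ys_def)
  have "cok I E gs'"
    using blk m sp cap st cj by (force simp: block_def gs'_def su_def)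
  moreover have "camounts gs' i + remain (snd (snd F)) i = remain xs0 i" for i
  proof -
    have "camounts gs i + remain ((j, r) # xs) i = remain xs0 i" using blk by (auto simp: block_def)
    moreover have "amounts (fst F) i + remain (snd (snd F)) i = remain ys i"
      unfolding F_def by (rule fill_amounts)
    ultimately show ?thesis by (simp add: gs'_def su_def ys_def split: if_splits)
  qed
  moreover have "valid I (snd (snd F))" using fill_valid[OF ys, of cap E] cap by (simp add: F_def)
  moreover have "fst ` set (snd (snd F)) \<subseteq> fst ` set xs0"
  proof -
    have "fst ` set (snd (snd F)) \<subseteq> fst ` set ys"
      unfolding F_def using fill_jobs by blast
    also have "\<dots> = fst ` set ((j, r) # xs)" by (simp add: ys_def)
    finally show ?thesis using sub by (rule subset_trans)
  qed
  moreover have "need I ((j, r) # xs) + real (count gs) * cap \<le> need I xs0"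
    using blk by (simp add: block_def)
  then have nd: "need I ys + (real (count gs) + real k) * cap \<le> need I xs0"
    unfolding ys_def need_reduce by (simp add: algebra_simps)
  moreover have "real (count gs') = real (count gs) + real k + 1" by (simp add: gs'_def)
  moreover have "snd (snd F) \<noteq> [] \<Longrightarrow> need I (snd (snd F)) + cap \<le> need I ys"
    "snd (snd F) = [] \<Longrightarrow> cap \<le> need I ys + fst (snd F)"
    using fill_need[OF ys, of cap E] cap by (auto simp: F_def)
  ultimately show "block I E cap xs0 gs' (snd (snd F)) (fst (snd F))"
    using m sp unfolding block_def by (auto simp: gs'_def algebra_simps)
qed

section \<open>The schedule\<close>

definition whole :: "inst \<Rightarrow> nat list \<Rightarrow> (nat \<times> real) list" where
  "whole I js = map (\<lambda>j. (j, real (ptime I j))) js"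

lemma whole_simps [simp]:
  "whole I [] = []" "whole I (j # js) = (j, real (ptime I j)) # whole I js"
  "whole I (js @ js') = whole I js @ whole I js'" "length (whole I js) = length js"
  "map fst (whole I js) = js" "whole I js = [] \<longleftrightarrow> js = []" "fst ` set (whole I js) = set js"
  by (simp_all add: whole_def comp_def image_image)

lemma valid_whole: "wf_inst I \<Longrightarrow> set js \<subseteq> {..<jobs I} \<Longrightarrow> valid I (whole I js)"
  by (induction js) (auto simp: wf_inst_def)

lemma remain_whole:
  "distinct js \<Longrightarrow> remain (whole I js) j = (if j \<in> set js then real (ptime I j) else 0)"
  by (induction js) auto

lemma need_whole_single:
  "\<forall>j\<in>set js. cls I j = i \<Longrightarrow> need I (whole I js) = (\<Sum>j\<leftarrow>js. real (ptime I j))"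
proof (induction js)
  case (Cons j js)
  then show ?case by (cases js) auto
qed auto

text \<open>The setup of the first class is put back, so that concatenations can be bounded class by
  class.\<close>

definition full_need :: "inst \<Rightarrow> nat list \<Rightarrow> real" where
  "full_need I js = need I (whole I js) + (if js = [] then 0 else real (stime I (cls I (hd js))))"

lemma full_need_append:
  assumes "\<forall>j\<in>set js. cls I j = i"
  shows "full_need I (js @ js') \<le> (\<Sum>j\<leftarrow>js. real (ptime I j)) + real (stime I i) + full_need I js'"
  using assms
proof (induction js)
  case (Cons j js)
  show ?case
  proof (cases js)
    case Nil
    with Cons show ?thesis by (cases js') (auto simp: full_need_def)
  next
    case (Cons j2 js2)
    with Cons.IH Cons.prems show ?thesis by (auto simp: full_need_def)
  qed
qed (simp add: full_need_def)

text \<open>Reversed because the program inserts each job at the front of the list of its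
  class.\<close>

definition jobs_upto :: "inst \<Rightarrow> nat \<Rightarrow> nat \<Rightarrow> nat list" where
  "jobs_upto I n i = rev (filter (\<lambda>j. cls I j = i) [0..<n])"

abbreviation class_list :: "inst \<Rightarrow> nat \<Rightarrow> nat list" where
  "class_list I i \<equiv> jobs_upto I (jobs I) i"

lemma jobs_upto_simps [simp]:
  "jobs_upto I 0 i = []"
  "jobs_upto I (Suc n) i = (if cls I n = i then [n] else []) @ jobs_upto I n i"
  "distinct (jobs_upto I n i)"
  by (simp_all add: jobs_upto_def)

lemma set_jobs_upto: "set (jobs_upto I n i) = {j. j < n \<and> cls I j = i}"
  by (auto simp: jobs_upto_def)

lemma sum_class_list: "(\<Sum>j\<leftarrow>class_list I i. real (ptime I j)) = real (load I (class_jobs I i))"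
proof -
  have "(\<Sum>j\<leftarrow>class_list I i. real (ptime I j)) = (\<Sum>j\<in>set (class_list I i). real (ptime I j))"
    by (simp add: sum_list_distinct_conv_sum_set)
  then show ?thesis by (simp add: set_jobs_upto load_def class_jobs_def)
qed

text \<open>Classes descend because the program prepends the list of each cheap class to those
  already joined.\<close>

fun cheap_list :: "inst \<Rightarrow> real \<Rightarrow> nat \<Rightarrow> nat list" where
  "cheap_list I T 0 = []"
| "cheap_list I T (Suc i) = (if real (stime I i) \<le> T / 2 then class_list I i else []) @ cheap_list I T i"

lemma set_cheap_list:
  "set (cheap_list I T c) = {j. j < jobs I \<and> cls I j < c \<and> real (stime I (cls I j)) \<le> T / 2}"
  by (induction c) (auto simp: set_jobs_upto less_Suc_eq)

lemma distinct_cheap_list: "distinct (cheap_list I T c)"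
  by (induction c) (auto simp: set_jobs_upto set_cheap_list)

lemma full_need_cheap_list:
  "full_need I (cheap_list I T c) \<le>
    (\<Sum>i\<in>{i. i < c \<and> real (stime I i) \<le> T / 2}. real (load I (class_jobs I i)) + real (stime I i))"
proof (induction c)
  case (Suc c)
  have *: "{i. i < Suc c \<and> real (stime I i) \<le> T / 2} =
      (if real (stime I c) \<le> T / 2 then {c} else {}) \<union> {i. i < c \<and> real (stime I i) \<le> T / 2}"
    by (auto simp: less_Suc_eq)
  show ?case
    using Suc full_need_append[of "class_list I c" I c "cheap_list I T c"]
    unfolding * by (auto simp: set_jobs_upto sum_class_list)
qed (simp add: full_need_def)

text \<open>The share of \<open>L_split\<close> that stays reserved for the expensive classes not
  yet scheduled.\<close>

definition exp_load :: "inst \<Rightarrow> real \<Rightarrow> nat \<Rightarrow> real" where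
  "exp_load I T i = (\<Sum>i'\<in>{i'\<in>I_exp I T. i \<le> i'}.
     real (load I (class_jobs I i')) + real_of_int (beta I T i') * real (stime I i'))"

definition exp_machines :: "inst \<Rightarrow> real \<Rightarrow> nat \<Rightarrow> real" where
  "exp_machines I T i = (\<Sum>i'\<in>{i'\<in>I_exp I T. i' < i}. real_of_int (beta I T i'))"

text \<open>The situation before class \<open>i\<close>: the expensive classes below \<open>i\<close> are scheduled, and so are the
  cheap classes up to the stream \<open>ys\<close>. As long as cheap load remains, every machine in use is
  responsible for load at least \<open>T\<close>.\<close>

definition progress :: "inst \<Rightarrow> real \<Rightarrow> nat \<Rightarrow> csched \<Rightarrow> (nat \<times> real) list \<Rightarrow> bool" where
  "progress I T i cs ys \<longleftrightarrow>
     cok I (3 / 2 * T) cs \<and> valid I ys \<and> (\<forall>x\<in>set ys. real (stime I (cls I (fst x))) \<le> T / 2) \<and>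
     (\<forall>j<jobs I. camounts cs j + remain ys j =
        (if real (stime I (cls I j)) \<le> T / 2 \<or> cls I j < i then real (ptime I j) else 0)) \<and>
     real (count cs) \<le> exp_machines I T i \<and>
     (ys \<noteq> [] \<longrightarrow> need I ys + exp_load I T i + real (count cs) * T \<le> real (machines I) * T)"

lemma exp_load_step:
  "exp_load I T i = (if i \<in> I_exp I T
     then real (load I (class_jobs I i)) + real_of_int (beta I T i) * real (stime I i) else 0)
     + exp_load I T (Suc i)"
proof -
  have "{i'\<in>I_exp I T. i \<le> i'} = (if i \<in> I_exp I T then {i} else {}) \<union> {i'\<in>I_exp I T. Suc i \<le> i'}"
    by (auto simp: Suc_le_eq le_less)
  moreover have "finite (I_exp I T)" by (simp add: I_exp_def)
  ultimately show ?thesis unfolding exp_load_def by auto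
qed

lemma exp_machines_step:
  "exp_machines I T (Suc i) = (if i \<in> I_exp I T then real_of_int (beta I T i) else 0) + exp_machines I T i"
proof -
  have "{i'\<in>I_exp I T. i' < Suc i} = (if i \<in> I_exp I T then {i} else {}) \<union> {i'\<in>I_exp I T. i' < i}"
    by (auto simp: less_Suc_eq)
  moreover have "finite (I_exp I T)" by (simp add: I_exp_def)
  ultimately show ?thesis unfolding exp_machines_def by auto
qed

text \<open>\<open>L_split\<close> counts a setup for every cheap class, including the first one,
  which \<open>need\<close> gets for free. So cheap need plus the reserve
  \<open>exp_load I T 0\<close> is at most \<open>L_split I T\<close>, and \<open>L\<close> becomes
  the initial budget.\<close>

lemma progress_init:
  assumes wf: "wf_inst I" and L: "real_of_int (L_split I T) \<le> real (machines I) * T"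
  shows "progress I T 0 [] (whole I (cheap_list I T (classes I)))"
proof -
  let ?js = "cheap_list I T (classes I)"
  have cl: "\<forall>j<jobs I. cls I j < classes I" using wf by (auto simp: wf_inst_def)
  have "need I (whole I ?js) \<le> full_need I ?js" by (simp add: full_need_def)
  also have "\<dots> \<le> (\<Sum>i\<in>I_chp I T. real (load I (class_jobs I i)) + real (stime I i))"
    using full_need_cheap_list[of I T "classes I"] by (simp add: I_chp_def)
  finally have n: "need I (whole I ?js) \<le> \<dots>" .
  have "real (load I {..<jobs I}) = (\<Sum>i<classes I. real (load I (class_jobs I i)))"
    using sum_classes[OF cl, of "\<lambda>j. real (ptime I j)"] by (simp add: load_def)
  also have "\<dots> = (\<Sum>i\<in>I_chp I T. real (load I (class_jobs I i))) + (\<Sum>i\<in>I_exp I T. real (load I (class_jobs I i)))"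
    by (rule split_classes)
  finally have "(\<Sum>i\<in>I_chp I T. real (load I (class_jobs I i)) + real (stime I i)) + exp_load I T 0
      = real_of_int (L_split I T)"
    by (simp add: L_split_def exp_load_def sum.distrib)
  moreover have "valid I (whole I ?js)" using wf by (intro valid_whole) (auto simp: set_cheap_list)
  moreover have "\<forall>x\<in>set (whole I ?js). real (stime I (cls I (fst x))) \<le> T / 2"
    by (auto simp: whole_def set_cheap_list)
  ultimately show ?thesis using n L cl
    by (auto simp: progress_def remain_whole distinct_cheap_list set_cheap_list exp_machines_def)
qed

lemma progress_cheap:
  assumes "progress I T i cs ys" "i < classes I" "real (stime I i) \<le> T / 2"
  shows "progress I T (Suc i) cs ys"
proof -
  have "i \<notin> I_exp I T" using assms by (simp add: I_exp_def)
  with assms show ?thesis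
    using exp_load_step[of I T i] exp_machines_step[of I T i]
    by (auto simp: progress_def less_Suc_eq)
qed

text \<open>The last interval is partly used (\<open>sp < cap\<close>), so the real bound rounds to
  a ceiling. For \<open>cap = T / 2\<close> and the load of class \<open>i\<close> this is
  \<open>beta I T i\<close>.\<close>

lemma block_count:
  assumes "block I E cap xs gs [] sp" "0 < cap"
  shows "int (count gs) \<le> \<lceil>need I xs / cap\<rceil>"
proof -
  have "real (count gs) * cap < need I xs + cap" using assms by (auto simp: block_def)
  then have "real (count gs) - 1 < need I xs / cap" using assms(2) by (simp add: field_simps)
  then show ?thesis by linarith
qed

text \<open>The last machine ends at \<open>stime I i + T / 2 - sp\<close>; with another
  \<open>T / 2\<close> kept for a cheap setup, the space up to \<open>3 / 2 * T\<close> is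
  \<open>gap\<close>. If \<open>gap \<le> 0\<close>, the machines already account for
  \<open>T\<close> each on average; otherwise the cheap load wrapped into \<open>gap\<close>
  supplies what is missing.\<close>

lemma progress_expensive:
  assumes prog: "progress I T i cs ys" and i: "i \<in> I_exp I T" and T: "0 < T"
    and wf: "wf_inst I" and sT: "real (stime I i) \<le> T"
    and blk: "block I (real (stime I i) + T / 2) (T / 2) (whole I (class_list I i)) gs [] sp"
  defines "gap \<equiv> T / 2 - real (stime I i) + sp"
  shows "ys = [] \<or> gap \<le> 0 \<Longrightarrow> progress I T (Suc i) (cs @ gs) ys"
    and "ys \<noteq> [] \<Longrightarrow> 0 < gap \<Longrightarrow> gs = gs' @ [(1, M)] \<Longrightarrow>
      fill I (3 / 2 * T) gap ys = (its, sp', zs) \<Longrightarrow>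
      progress I T (Suc i) (cs @ gs' @ [(1, M @ Setup (cls I (fst (hd ys)))
        (3 / 2 * T - gap - real (stime I (cls I (fst (hd ys))))) # its)]) zs"
proof -
  let ?P = "real (load I (class_jobs I i))"
  have i': "i < classes I" "T / 2 < real (stime I i)" using i by (auto simp: I_exp_def)
  have cl: "\<forall>j<jobs I. cls I j < classes I" using wf by (auto simp: wf_inst_def)
  have nd: "need I (whole I (class_list I i)) = ?P"
    by (simp add: need_whole_single[of _ I i] set_jobs_upto sum_class_list)
  have sp: "0 \<le> sp" "sp < T / 2" and cnt: "real (count gs) * (T / 2) \<le> ?P + sp"
    using blk nd by (auto simp: block_def)
  have "int (count gs) \<le> beta I T i"
    using block_count[OF blk] T unfolding nd beta_def by (simp add: field_simps)
  then have beta: "real (count gs) \<le> real_of_int (beta I T i)" by linarith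
  have am: "camounts gs j = (if cls I j = i then real (ptime I j) else 0)" if "j < jobs I" for j
    using blk that by (auto simp: block_def remain_whole set_jobs_upto)
  have okgs: "cok I (3 / 2 * T) gs" using blk sT by (auto simp: block_def intro: cok_mono)
  have mach: "exp_machines I T (Suc i) = real_of_int (beta I T i) + exp_machines I T i"
    using exp_machines_step[of I T i] i by simp
  obtain gs1 M1 where "gs = gs1 @ [(1, M1)]" using blk by (auto simp: block_def)
  then have "1 \<le> real (count gs)" by simp
  \<comment> \<open>One setup is set aside to cancel the \<open>- real (stime I i)\<close> in
    \<open>gap\<close>; the other \<open>count gs - 1\<close> machines are compared with
    \<open>beta I T i - 1\<close> setups, each longer than \<open>T / 2\<close>.\<close>
  then have "(real (count gs) - 1) * (T / 2) \<le> (real_of_int (beta I T i) - 1) * real (stime I i)"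
    using beta i' T by (intro mult_mono) auto
  then have key: "real (count gs) * T - gap \<le> ?P + real_of_int (beta I T i) * real (stime I i)"
    using cnt by (simp add: gap_def field_simps)
  {
    assume "ys = [] \<or> gap \<le> 0"
    then have "ys \<noteq> [] \<longrightarrow> need I ys + exp_load I T (Suc i) + real (count (cs @ gs)) * T \<le> real (machines I) * T"
      using prog key exp_load_step[of I T i] i by (auto simp: progress_def algebra_simps)
    then show "progress I T (Suc i) (cs @ gs) ys"
      using prog okgs am beta mach i' unfolding progress_def
      by (auto simp: less_Suc_eq)
  }
  assume ys: "ys \<noteq> []" and gap: "0 < gap" and gs: "gs = gs' @ [(1, M)]"
    and F: "fill I (3 / 2 * T) gap ys = (its, sp', zs)"
  let ?N = "M @ Setup (cls I (fst (hd ys))) (3 / 2 * T - gap - real (stime I (cls I (fst (hd ys))))) # its"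
  have val: "valid I ys" and small: "\<forall>x\<in>set ys. real (stime I (cls I (fst x))) \<le> T / 2"
    using prog by (auto simp: progress_def)
  have sm: "real (stime I (cls I (fst (hd ys)))) \<le> T / 2" using small ys by simp
  have M: "machine_ok I None 0 M" "\<forall>y\<in>set M. item_end I y \<le> real (stime I i) + T / 2 - sp"
    using blk gs by (auto simp: block_def)
  have N: "machine_ok I None 0 ?N" "\<forall>y\<in>set ?N. item_end I y \<le> 3 / 2 * T - sp'"
    using filled_machine[OF val _ cl ys M(2) M(1), of gap "3 / 2 * T"] gap sp T F sm
    by (auto simp: gap_def)
  have sp': "0 \<le> sp'" using fill_space[OF val, of gap "3 / 2 * T"] gap F by simp
  define cs2 where "cs2 = cs @ gs' @ [(1, ?N)]"
  have ok: "cok I (3 / 2 * T) cs2"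
    using prog okgs N sp' by (force simp: progress_def gs cs2_def)
  have zs: "valid I zs" using fill_valid[OF val, of gap "3 / 2 * T"] gap F by simp
  have small': "\<forall>x\<in>set zs. real (stime I (cls I (fst x))) \<le> T / 2"
  proof
    fix x assume "x \<in> set zs"
    then have "fst x \<in> fst ` set ys" using fill_jobs[of x I "3 / 2 * T" gap ys] F by simp
    with small show "real (stime I (cls I (fst x))) \<le> T / 2" by auto
  qed
  have cam: "camounts cs2 j + remain zs j = camounts cs j + camounts gs j + remain ys j" for j
    using fill_amounts[of I "3 / 2 * T" gap ys j] F by (simp add: gs cs2_def)
  have cn: "count cs2 = count cs + count gs" by (simp add: gs cs2_def)
  have "zs \<noteq> [] \<longrightarrow> need I zs + exp_load I T (Suc i) + (real (count cs) + real (count gs)) * T \<le> real (machines I) * T"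
    using prog key exp_load_step[of I T i] i fill_need[OF val, of gap "3 / 2 * T"] F gap ys
    by (auto simp: progress_def algebra_simps)
  moreover have "camounts cs2 j + remain zs j =
      (if real (stime I (cls I j)) \<le> T / 2 \<or> cls I j < Suc i then real (ptime I j) else 0)"
    if j: "j < jobs I" for j
  proof -
    have "camounts cs j + remain ys j =
        (if real (stime I (cls I j)) \<le> T / 2 \<or> cls I j < i then real (ptime I j) else 0)"
      using prog j by (simp add: progress_def)
    then show ?thesis using cam[of j] am[OF j] i' by (auto simp: less_Suc_eq)
  qed
  ultimately show "progress I T (Suc i) (cs @ gs' @ [(1, ?N)]) zs"
    using prog ok zs small' beta mach unfolding progress_def cs2_def[symmetric] cn by auto
qed

section \<open>Expanding multiplicities and the final count of machines\<close>

lemma length_expand: "length (expand cs) = count cs"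
  by (induction cs) (auto simp: expand_def count_def)

lemma set_expand: "set (expand cs) \<subseteq> snd ` set cs"
  by (auto simp: expand_def split: if_splits) force+

lemma amount_expand: "(\<Sum>M\<leftarrow>expand cs. \<Sum>x\<leftarrow>M. amount j x) = camounts cs j"
  by (induction cs) (auto simp: expand_def camounts_def amounts_def sum_list_replicate)

lemma expand_schedule:
  assumes "cok I B cs" "count cs = machines I" "\<forall>j<jobs I. camounts cs j = real (ptime I j)" "0 \<le> B"
  shows "feasible I (expand cs)" "makespan I (expand cs) \<le> B"
proof -
  have ok: "machine_ok I None 0 M" "\<forall>y\<in>set M. item_end I y \<le> B" if "M \<in> set (expand cs)" for M
    using assms(1) set_expand[of cs] that by (fastforce simp: cok_def)+
  then show "feasible I (expand cs)"
    using assms by (auto simp: feasible_def length_expand amount_expand)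
  show "makespan I (expand cs) \<le> B"
    unfolding makespan_def using assms(4) ok(2) by (subst Max_le_iff) auto
qed

text \<open>Without cheap load left, the machines are counted by \<open>m_exp\<close>; with cheap
  load left, each of them has consumed \<open>T\<close> of the budget. The empty configuration pads
  the schedule to exactly \<open>machines I\<close> machines.\<close>

lemma progress_final:
  assumes prog: "progress I T (classes I) cs ys" and T: "0 < T" and wf: "wf_inst I"
    and m: "m_exp I T \<le> int (machines I)"
    and gs: "if ys = [] then gs = [] else block I (3 / 2 * T) T ys gs [] sp"
  defines "cs' \<equiv> cs @ gs @ [(machines I - count (cs @ gs), [])]"
  shows "feasible I (expand cs')" "makespan I (expand cs') \<le> 3 / 2 * T"
    "count (cs @ gs) \<le> machines I"
proof -
  have cl: "\<forall>j<jobs I. cls I j < classes I" using wf by (auto simp: wf_inst_def)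
  have ok: "cok I (3 / 2 * T) (cs @ gs)" using prog gs by (auto simp: progress_def block_def split: if_splits)
  have cam: "camounts (cs @ gs) j = real (ptime I j)" if "j < jobs I" for j
  proof -
    have "camounts gs j = remain ys j" using gs by (auto simp: block_def split: if_splits)
    then show ?thesis using prog cl that by (auto simp: progress_def)
  qed
  show cnt: "count (cs @ gs) \<le> machines I"
  proof (cases "ys = []")
    case True
    have "{i'\<in>I_exp I T. i' < classes I} = I_exp I T" by (auto simp: I_exp_def)
    then have "exp_machines I T (classes I) = real_of_int (m_exp I T)"
      by (simp add: exp_machines_def m_exp_def)
    then show ?thesis using prog m gs True by (simp add: progress_def)
  next
    case False
    have "{i'\<in>I_exp I T. classes I \<le> i'} = {}" by (auto simp: I_exp_def)
    then have e: "exp_load I T (classes I) = 0" by (simp only: exp_load_def sum.empty)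
    \<comment> \<open>Less than \<open>T\<close> is wasted on the very last machine, so the count
      stays strictly below \<open>m + 1\<close>, which suffices for integers.\<close>
    from False gs have "real (count gs) * T < need I ys + T" by (auto simp: block_def)
    with False prog e have "(real (count cs) + real (count gs)) * T < (real (machines I) + 1) * T"
      by (auto simp: progress_def algebra_simps)
    with T have "real (count cs) + real (count gs) < real (machines I) + 1" by simp
    then show ?thesis by simp
  qed
  have "cok I (3 / 2 * T) cs'" "count cs' = machines I" "\<forall>j<jobs I. camounts cs' j = real (ptime I j)"
    using ok cnt cam by (auto simp: cs'_def)
  from expand_schedule[OF this] T
  show "feasible I (expand cs')" "makespan I (expand cs') \<le> 3 / 2 * T" by auto
qed

section \<open>Reasoning about programs\<close>

text \<open>Total correctness with the step count visible to \<open>Q\<close>; it fails for stuck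
  runs. The equivalences for it let the simplifier execute straight-line code symbolically.\<close>

definition run :: "nat \<Rightarrow> com \<Rightarrow> state \<Rightarrow> (nat \<Rightarrow> state \<Rightarrow> bool) \<Rightarrow> bool" where
  "run W p \<sigma> Q \<longleftrightarrow> (\<exists>k \<sigma>'. exec W p \<sigma> k \<sigma>' \<and> Q k \<sigma>')"

inductive_cases exec_SKIP: "exec W SKIP \<sigma> k \<sigma>'"
inductive_cases exec_Assign: "exec W (Assign x a) \<sigma> k \<sigma>'"
inductive_cases exec_Floor: "exec W (Floor x a) \<sigma> k \<sigma>'"
inductive_cases exec_Load: "exec W (Load x A a) \<sigma> k \<sigma>'"
inductive_cases exec_Store: "exec W (Store A a b) \<sigma> k \<sigma>'"
inductive_cases exec_Seq: "exec W (Seq p q) \<sigma> k \<sigma>'"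
inductive_cases exec_If: "exec W (If b p q) \<sigma> k \<sigma>'"
inductive_cases exec_While: "exec W (While b p) \<sigma> k \<sigma>'"

lemma run_simps [simp]:
  shows run_SKIP: "run W SKIP \<sigma> Q \<longleftrightarrow> Q 1 \<sigma>"
    and run_Assign: "run W (Assign x a) \<sigma> Q \<longleftrightarrow> Q 1 (set_reg x (aval a \<sigma>) \<sigma>)"
    and run_Floor: "run W (Floor x a) \<sigma> Q \<longleftrightarrow>
      \<bar>aval a \<sigma>\<bar> \<le> real W \<and> Q 1 (set_reg x (of_int \<lfloor>aval a \<sigma>\<rfloor>) \<sigma>)"
    and run_Load: "run W (Load x A a) \<sigma> Q \<longleftrightarrow>
      (\<exists>i. aval a \<sigma> = real i \<and> i \<le> W \<and> Q 1 (set_reg x (arr \<sigma> A i) \<sigma>))"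
    and run_Store: "run W (Store A a b) \<sigma> Q \<longleftrightarrow>
      (\<exists>i. aval a \<sigma> = real i \<and> i \<le> W \<and> Q 1 (set_cell A i (aval b \<sigma>) \<sigma>))"
    and run_Seq: "run W (Seq p q) \<sigma> Q \<longleftrightarrow> run W p \<sigma> (\<lambda>k \<sigma>'. run W q \<sigma>' (\<lambda>k'. Q (k + k')))"
  unfolding run_def One_nat_def
       apply (blast elim: exec_SKIP intro: exec.Skip[unfolded One_nat_def])
      apply (blast elim: exec_Assign intro: exec.Assign[unfolded One_nat_def])
     apply (blast elim: exec_Floor intro: exec.Floor[unfolded One_nat_def])
    apply (blast elim: exec_Load intro: exec.Load[unfolded One_nat_def])
   apply (blast elim: exec_Store intro: exec.Store[unfolded One_nat_def])
  apply (blast elim: exec_Seq intro: exec.Seq)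
  done

lemma run_If:
  "run W (If b p q) \<sigma> Q \<longleftrightarrow>
     (if bval b \<sigma> then run W p \<sigma> (\<lambda>k. Q (1 + k)) else run W q \<sigma> (\<lambda>k. Q (1 + k)))"
  unfolding run_def
  by (cases "bval b \<sigma>") (simp; blast elim: exec_If intro: exec.IfTrue[simplified] exec.IfFalse[simplified])+

lemma run_While:
  "run W (While b p) \<sigma> Q \<longleftrightarrow>
     (if bval b \<sigma> then run W p \<sigma> (\<lambda>k \<sigma>'. run W (While b p) \<sigma>' (\<lambda>k'. Q (1 + k + k'))) else Q 1 \<sigma>)"
  unfolding run_def
proof (cases "bval b \<sigma>", goal_cases)
  case 1
  then show ?case by simp (blast elim: exec_While intro: exec.WhileTrue[simplified])
next
  case 2
  then show ?case by simp (blast elim: exec_While intro: exec.WhileFalse[simplified])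
qed

lemma run_mono: "run W p \<sigma> Q \<Longrightarrow> (\<And>k \<sigma>'. Q k \<sigma>' \<Longrightarrow> Q' k \<sigma>') \<Longrightarrow> run W p \<sigma> Q'"
  by (auto simp: run_def)

text \<open>The ghost argument of the invariant is a bound on the remaining running time.\<close>

lemma run_While_potential:
  fixes f :: nat
  assumes "Inv f \<sigma>"
    and step: "\<And>f \<sigma>. Inv f \<sigma> \<Longrightarrow> bval b \<sigma> \<Longrightarrow>
      run W p \<sigma> (\<lambda>k \<sigma>'. \<exists>f'. Inv f' \<sigma>' \<and> k + 1 + f' \<le> f)"
    and post: "\<And>f' \<sigma>' k. Inv f' \<sigma>' \<Longrightarrow> \<not> bval b \<sigma>' \<Longrightarrow> k + f' \<le> f + 1 \<Longrightarrow> Q k \<sigma>'"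
  shows "run W (While b p) \<sigma> Q"
  using assms(1) post
proof (induction f arbitrary: \<sigma> Q rule: less_induct)
  case (less f)
  show ?case
  proof (cases "bval b \<sigma>")
    case True
    show ?thesis
      unfolding run_While[of W b p \<sigma>] if_P[OF True]
    proof (rule run_mono[OF step[OF less.prems(1) True]], elim exE conjE)
      fix k \<sigma>' f' assume *: "Inv f' \<sigma>'" "k + 1 + f' \<le> f"
      show "run W (While b p) \<sigma>' (\<lambda>k'. Q (1 + k + k'))"
        using * by (intro less.IH[of f']) (auto intro!: less.prems(2))
    qed
  next
    case False
    then show ?thesis using less.prems by (subst run_While) auto
  qed
qed

lemma state_simps [simp]:
  "reg (set_reg x v \<sigma>) y = (if y = x then v else reg \<sigma> y)"
  "arr (set_reg x v \<sigma>) = arr \<sigma>"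
  "reg (set_cell A i v \<sigma>) = reg \<sigma>"
  "arr (set_cell A i v \<sigma>) B = (if B = A then (arr \<sigma> A)(i := v) else arr \<sigma> B)"
  by (auto simp: set_reg_def set_cell_def)

lemma aval_set_cell [simp]: "aval a (set_cell A i v \<sigma>) = aval a \<sigma>"
  by (induction a) auto

definition same :: "string set \<Rightarrow> string set \<Rightarrow> state \<Rightarrow> state \<Rightarrow> bool" where
  "same R A \<sigma> \<sigma>' \<longleftrightarrow> (\<forall>x. x \<notin> R \<longrightarrow> reg \<sigma>' x = reg \<sigma> x) \<and> (\<forall>a. a \<notin> A \<longrightarrow> arr \<sigma>' a = arr \<sigma> a)"

lemma same_trans: "same R A \<sigma> \<sigma>' \<Longrightarrow> same R A \<sigma>' \<sigma>'' \<Longrightarrow> same R A \<sigma> \<sigma>''"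
  by (auto simp: same_def)

lemma same_mono: "same R A \<sigma> \<sigma>' \<Longrightarrow> R \<subseteq> R' \<Longrightarrow> A \<subseteq> A' \<Longrightarrow> same R' A' \<sigma> \<sigma>'"
  by (auto simp: same_def)

lemma same_set_reg: "same R A \<sigma> \<sigma>' \<Longrightarrow> x \<in> R \<Longrightarrow> same R A \<sigma> (set_reg x v \<sigma>')"
  by (auto simp: same_def)

section \<open>Writing the output\<close>

text \<open>\<open>b\<close> is a reserve: the number of items and groups that may still be written
  before an address could exceed \<open>W\<close>.\<close>

definition out :: "nat \<Rightarrow> nat \<Rightarrow> state \<Rightarrow> csched \<Rightarrow> bool" where
  "out W b \<sigma> cs \<longleftrightarrow> outputs \<sigma> cs \<and> reg \<sigma> ''p'' = real (length (concat (map snd cs))) \<and>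
     reg \<sigma> ''used'' = real (count cs) \<and>
     length (concat (map snd cs)) + b \<le> W \<and> length cs + b \<le> W"

definition out_regs :: "string set" where "out_regs = {''p'', ''l'', ''groups'', ''used''}"

definition out_arrs :: "string set" where
  "out_arrs = {''mult'', ''len'', ''kind'', ''id'', ''start'', ''dur''}"

lemma out_mono: "out W b \<sigma> cs \<Longrightarrow> b' \<le> b \<Longrightarrow> out W b' \<sigma> cs"
  by (auto simp: out_def)

lemma holds_item_cong:
  "(\<And>A. A \<in> {''kind'', ''id'', ''start'', ''dur''} \<Longrightarrow> arr \<sigma>' A p = arr \<sigma> A p) \<Longrightarrow>
    holds_item \<sigma>' p x = holds_item \<sigma> p x"
  by (cases x) auto

lemma out_cong:
  assumes "\<And>x. x \<in> {''p'', ''groups'', ''used''} \<Longrightarrow> reg \<sigma>' x = reg \<sigma> x"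
    "\<And>A. A \<in> out_arrs \<Longrightarrow> arr \<sigma>' A = arr \<sigma> A"
  shows "out W b \<sigma>' cs = out W b \<sigma> cs"
proof -
  have "holds_item \<sigma>' p x = holds_item \<sigma> p x" for p x
    using assms(2) by (intro holds_item_cong) (auto simp: out_arrs_def)
  then show ?thesis using assms by (simp add: out_def outputs_def out_arrs_def Let_def)
qed

lemma out_set_reg [simp]:
  "x \<notin> {''p'', ''groups'', ''used''} \<Longrightarrow> out W b (set_reg x v \<sigma>) cs = out W b \<sigma> cs"
  by (rule out_cong) auto

definition new_group :: "aexp \<Rightarrow> com" where
  "new_group a = Seq (Store ''mult'' (V ''groups'') a) (Seq (Store ''len'' (V ''groups'') (N 0))
     (Seq (Assign ''used'' (Plus (V ''used'') a)) (Assign ''groups'' (Plus (V ''groups'') (N 1)))))"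

text \<open>The length of the last group is kept in the array, so that cheap load can later be
  appended to the last machine of a finished expensive class. For setups the value \<open>d\<close>
  is a dummy.\<close>

definition emit :: "int \<Rightarrow> aexp \<Rightarrow> aexp \<Rightarrow> aexp \<Rightarrow> com" where
  "emit knd i s d = Seq (Store ''kind'' (V ''p'') (N knd)) (Seq (Store ''id'' (V ''p'') i)
     (Seq (Store ''start'' (V ''p'') s) (Seq (Store ''dur'' (V ''p'') d)
     (Seq (Assign ''p'' (Plus (V ''p'') (N 1))) (Seq (Load ''l'' ''len'' (Minus (V ''groups'') (N 1)))
     (Store ''len'' (Minus (V ''groups'') (N 1)) (Plus (V ''l'') (N 1))))))))"

lemma run_new_group:
  assumes out: "out W (Suc b) \<sigma> cs" and a: "aval a \<sigma> = real k"
    and Q: "\<And>\<sigma>'. out W b \<sigma>' (cs @ [(k, [])]) \<Longrightarrow> same out_regs out_arrs \<sigma> \<sigma>' \<Longrightarrow> Q 4 \<sigma>'"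
  shows "run W (new_group a) \<sigma> Q"
proof -
  have g: "reg \<sigma> ''groups'' = real (length cs)" "length cs \<le> W"
    using out by (auto simp: out_def outputs_def)
  define \<sigma>' where "\<sigma>' = set_reg ''groups'' (real (length cs) + 1) (set_reg ''used'' (reg \<sigma> ''used'' + real k)
    (set_cell ''len'' (length cs) 0 (set_cell ''mult'' (length cs) (real k) \<sigma>)))"
  have "holds_item \<sigma>' p x = holds_item \<sigma> p x" for p x
    unfolding \<sigma>'_def by (rule holds_item_cong) auto
  then have "out W b \<sigma>' (cs @ [(k, [])])"
    using out by (auto simp: out_def outputs_def \<sigma>'_def nth_append Let_def)
  moreover have "same out_regs out_arrs \<sigma> \<sigma>'"
    by (auto simp: same_def \<sigma>'_def out_regs_def out_arrs_def)
  ultimately have "Q 4 \<sigma>'" by (rule Q)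
  then show ?thesis using g a by (auto simp: new_group_def \<sigma>'_def eval_nat_numeral)
qed

lemma run_emit:
  assumes out: "out W (Suc b) \<sigma> (cs @ [(k, M)])"
    and x: "x = (if knd = 0 then Setup i (aval s \<sigma>) else Piece i (aval s \<sigma>) (aval d \<sigma>))" "knd = 0 \<or> knd = 1"
    and i: "aval ia \<sigma> = real i"
    and Q: "\<And>\<sigma>'. out W b \<sigma>' (cs @ [(k, M @ [x])]) \<Longrightarrow> same out_regs out_arrs \<sigma> \<sigma>' \<Longrightarrow> Q 7 \<sigma>'"
  shows "run W (emit knd ia s d) \<sigma> Q"
proof -
  define its where "its = concat (map snd (cs @ [(k, M)]))"
  define p where "p = length its"
  have p: "reg \<sigma> ''p'' = real p" "p \<le> W" and g: "reg \<sigma> ''groups'' = real (length cs) + 1" "length cs \<le> W"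
    and l: "arr \<sigma> ''len'' (length cs) = real (length M)"
    and h: "\<And>q. q < p \<Longrightarrow> holds_item \<sigma> q (its ! q)"
    using out by (auto simp: out_def outputs_def its_def p_def Let_def nth_append)
  define \<sigma>1 where "\<sigma>1 = set_cell ''dur'' p (aval d \<sigma>) (set_cell ''start'' p (aval s \<sigma>)
     (set_cell ''id'' p (real i) (set_cell ''kind'' p (of_int knd) \<sigma>)))"
  define \<sigma>' where "\<sigma>' = set_cell ''len'' (length cs) (real (length M) + 1)
    (set_reg ''l'' (real (length M)) (set_reg ''p'' (real p + 1) \<sigma>1))"
  have its': "concat (map snd (cs @ [(k, M @ [x])])) = its @ [x]" by (simp add: its_def)
  have "holds_item \<sigma>' q (its ! q)" if "q < p" for q
  proof -
    have "holds_item \<sigma>' q (its ! q) = holds_item \<sigma> q (its ! q)"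
      using that unfolding \<sigma>'_def \<sigma>1_def by (intro holds_item_cong) auto
    then show ?thesis using h that by simp
  qed
  moreover have "holds_item \<sigma>' p x" using x by (auto simp: \<sigma>'_def \<sigma>1_def)
  ultimately have "\<forall>q < length (its @ [x]). holds_item \<sigma>' q ((its @ [x]) ! q)"
    by (auto simp: nth_append p_def less_Suc_eq)
  moreover have "\<forall>q < length (cs @ [(k, M @ [x])]).
      arr \<sigma>' ''mult'' q = real (fst ((cs @ [(k, M @ [x])]) ! q)) \<and>
      arr \<sigma>' ''len'' q = real (length (snd ((cs @ [(k, M @ [x])]) ! q)))"
    using out by (auto simp: out_def outputs_def \<sigma>'_def \<sigma>1_def nth_append less_Suc_eq)
  moreover have "reg \<sigma>' ''groups'' = real (length (cs @ [(k, M @ [x])]))"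
    using g by (simp add: \<sigma>'_def \<sigma>1_def)
  ultimately have "outputs \<sigma>' (cs @ [(k, M @ [x])])"
    unfolding outputs_def its' by (simp only: Let_def)
  moreover have "reg \<sigma>' ''used'' = reg \<sigma> ''used''" "reg \<sigma>' ''p'' = real (length (its @ [x]))"
    by (simp_all add: \<sigma>'_def \<sigma>1_def p_def)
  ultimately have "out W b \<sigma>' (cs @ [(k, M @ [x])])"
    using out unfolding out_def its' by (auto simp: its_def)
  moreover have "same out_regs out_arrs \<sigma> \<sigma>'"
    by (auto simp: same_def \<sigma>'_def \<sigma>1_def out_regs_def out_arrs_def)
  ultimately have Q': "Q 7 \<sigma>'" by (rule Q)
  show ?thesis
    using p g i l Q' by (auto simp: emit_def \<sigma>'_def \<sigma>1_def eval_nat_numeral)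
qed

section \<open>The program\<close>

fun seqs :: "com list \<Rightarrow> com" where
  "seqs [] = SKIP"
| "seqs (p # ps) = Seq p (seqs ps)"

text \<open>Linked lists of jobs; job \<open>j\<close> is represented by the pointer \<open>j + 1\<close>, and \<open>0\<close> ends a list.\<close>

fun chain :: "(nat \<Rightarrow> real) \<Rightarrow> real \<Rightarrow> nat list \<Rightarrow> bool" where
  "chain nx h [] \<longleftrightarrow> h = 0"
| "chain nx h (j # js) \<longleftrightarrow> h = real (Suc j) \<and> chain nx (nx j) js"

definition inp :: "inst \<Rightarrow> real \<Rightarrow> state \<Rightarrow> bool" where
  "inp I T \<sigma> \<longleftrightarrow> reg \<sigma> ''m'' = real (machines I) \<and> reg \<sigma> ''n'' = real (jobs I) \<and>
     reg \<sigma> ''c'' = real (classes I) \<and> reg \<sigma> ''T'' = T \<and>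
     (\<forall>j<jobs I. arr \<sigma> ''cls'' j = real (cls I j) \<and> arr \<sigma> ''t'' j = real (ptime I j)) \<and>
     (\<forall>i<classes I. arr \<sigma> ''s'' i = real (stime I i))"

text \<open>Only the head can be partly processed, so its remainder sits in the register
  \<open>y\<close>; all other remainders are the input times.\<close>

definition stream :: "inst \<Rightarrow> state \<Rightarrow> string \<Rightarrow> string \<Rightarrow> (nat \<times> real) list \<Rightarrow> bool" where
  "stream I \<sigma> x y xs \<longleftrightarrow> chain (arr \<sigma> ''nxt'') (reg \<sigma> x) (map fst xs) \<and>
     (xs \<noteq> [] \<longrightarrow> reg \<sigma> y = snd (hd xs)) \<and> (\<forall>x\<in>set (tl xs). snd x = real (ptime I (fst x)))"

lemma real_Suc_minus_one [simp]: "real (Suc j) - 1 = real j"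
  by simp

text \<open>Tests offer only \<open>Less\<close>, so the program checks equality of class numbers by
  two failing comparisons.\<close>

lemma not_less_both_iff: "\<not> (x :: nat) < y \<and> \<not> y < x \<longleftrightarrow> x = y"
  by auto

lemma inp_same:
  "inp I T \<sigma> \<Longrightarrow> same R A \<sigma> \<sigma>' \<Longrightarrow> R \<inter> {''m'', ''n'', ''c'', ''T''} = {} \<Longrightarrow>
    A \<inter> {''cls'', ''t'', ''s''} = {} \<Longrightarrow> inp I T \<sigma>'"
  by (auto simp: inp_def same_def disjoint_iff)

lemma inp_set_reg [simp]: "x \<notin> {''m'', ''n'', ''c'', ''T''} \<Longrightarrow> inp I T (set_reg x v \<sigma>) = inp I T \<sigma>"
  by (auto simp: inp_def)

text \<open>Register \<open>go\<close> is the loop flag; the loop computes \<open>fill\<close> on the stream in \<open>j\<close>, \<open>rem\<close>.\<close>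

definition fill_body :: com where
  "fill_body =
    If (Less (V ''sp'') (V ''rem''))
      (seqs [emit 1 (Minus (V ''j'') (N 1)) (Minus (V ''E'') (V ''sp'')) (V ''sp''),
             Assign ''rem'' (Minus (V ''rem'') (V ''sp'')), Assign ''sp'' (N 0), Assign ''go'' (N 0)])
      (seqs [emit 1 (Minus (V ''j'') (N 1)) (Minus (V ''E'') (V ''sp'')) (V ''rem''),
             Assign ''sp'' (Minus (V ''sp'') (V ''rem'')),
             Load ''ci'' ''cls'' (Minus (V ''j'') (N 1)), Load ''j'' ''nxt'' (Minus (V ''j'') (N 1)),
             If (Less (N 0) (V ''j''))
               (seqs [Load ''rem'' ''t'' (Minus (V ''j'') (N 1)), Load ''cn'' ''cls'' (Minus (V ''j'') (N 1)),
                      If (And (Not (Less (V ''cn'') (V ''ci''))) (Not (Less (V ''ci'') (V ''cn'')))) SKIP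
                        (seqs [Load ''si'' ''s'' (V ''cn''),
                               If (Less (V ''sp'') (V ''si'')) (Assign ''go'' (N 0))
                                 (seqs [emit 0 (V ''cn'') (Minus (V ''E'') (V ''sp'')) (N 0),
                                        Assign ''sp'' (Minus (V ''sp'') (V ''si''))])])])
               (Assign ''go'' (N 0))])"

definition fill_com :: com where
  "fill_com = While (Less (N 0) (V ''go'')) fill_body"

definition fill_regs :: "string set" where
  "fill_regs = out_regs \<union> {''j'', ''rem'', ''sp'', ''go'', ''ci'', ''cn'', ''si''}"

lemma fill_regs_simps [simp]:
  "''j'' \<in> fill_regs" "''rem'' \<in> fill_regs" "''sp'' \<in> fill_regs" "''go'' \<in> fill_regs"
  "''ci'' \<in> fill_regs" "''cn'' \<in> fill_regs" "''si'' \<in> fill_regs" "out_regs \<subseteq> fill_regs"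
  by (auto simp: fill_regs_def)

lemma run_fill_stop: "reg \<sigma> ''go'' = 0 \<Longrightarrow> Q 1 \<sigma> \<Longrightarrow> run W fill_com \<sigma> Q"
  unfolding fill_com_def by (subst run_While) simp

text \<open>Each finished job costs constant time and at most two items, its piece and a setup. The
  extra 40 steps and the extra item pay for the last round, in which a job may be split and stay in
  the stream.\<close>

lemma run_fill:
  assumes "inp I T \<sigma>" "stream I \<sigma> ''j'' ''rem'' xs" "xs \<noteq> []" "valid I xs"
    and "\<forall>j<jobs I. cls I j < classes I" "jobs I \<le> W" "classes I \<le> W"
    and "reg \<sigma> ''go'' = 1" "reg \<sigma> ''sp'' = sp" "reg \<sigma> ''E'' = E"
    and "out W (2 * length xs + 1 + b) \<sigma> (cs @ [(k, M)])"
    and "fill I E sp xs = (its, sp', rest)"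
    and "\<And>t \<sigma>'. t + 40 * length rest \<le> 40 * length xs + 40 \<Longrightarrow>
      out W (2 * length rest + b) \<sigma>' (cs @ [(k, M @ its)]) \<Longrightarrow> stream I \<sigma>' ''j'' ''rem'' rest \<Longrightarrow>
      reg \<sigma>' ''sp'' = sp' \<Longrightarrow> same fill_regs out_arrs \<sigma> \<sigma>' \<Longrightarrow> Q t \<sigma>'"
  shows "run W fill_com \<sigma> Q"
  using assms
proof (induction xs arbitrary: \<sigma> sp M its b Q)
  case (Cons x xs)
  obtain j r where x: "x = (j, r)" by (cases x)
  note inp = Cons.prems(1) and strm = Cons.prems(2) and cl = Cons.prems(5) and W = Cons.prems(6,7)
    and out = Cons.prems(11) and F = Cons.prems(12) and Q = Cons.prems(13)
  have regs: "reg \<sigma> ''j'' = real (Suc j)" "reg \<sigma> ''rem'' = r" "reg \<sigma> ''go'' = 1" "reg \<sigma> ''sp'' = sp" "reg \<sigma> ''E'' = E"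
    and tl: "chain (arr \<sigma> ''nxt'') (arr \<sigma> ''nxt'' j) (map fst xs)" "\<forall>x\<in>set xs. snd x = real (ptime I (fst x))"
    using strm Cons.prems(8-10) by (auto simp: stream_def x)
  have j: "j < jobs I" and val: "valid I xs" using Cons.prems(4) by (auto simp: x)
  have "run W fill_body \<sigma> (\<lambda>k \<sigma>'. run W fill_com \<sigma>' (\<lambda>k'. Q (1 + k + k')))"
  proof (cases "sp < r")
    case True
    have F': "its = [Piece j (E - sp) sp]" "sp' = 0" "rest = (j, r - sp) # xs"
      using F True by (cases xs; auto simp: x)+
    show ?thesis
      unfolding fill_body_def run_If using True regs
      apply (simp del: of_nat_Suc)
      apply (rule run_emit[where x = "Piece j (E - sp) sp" and i = j, OF out_mono[OF out, of "Suc (2 * length rest + b)"]])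
          apply (simp_all add: F')
      apply (rule run_fill_stop, simp)
      apply (rule Q)
          apply (auto simp: F' x same_def out_regs_def out_arrs_def fill_regs_def stream_def tl)
      done
  next
    case False
    let ?p = "Piece j (E - sp) r"
    show ?thesis
      unfolding fill_body_def run_If using False regs
      apply (simp del: of_nat_Suc)
      apply (rule run_emit[where x = ?p and i = j, OF out_mono[OF out, of "Suc (2 * length xs + 2 + b)"]])
          apply simp
         apply simp
        apply simp
       apply simp
      subgoal premises p for \<sigma>1
      proof -
        have r1: "reg \<sigma>1 ''j'' = real (Suc j)" "reg \<sigma>1 ''rem'' = r" "reg \<sigma>1 ''go'' = 1" "reg \<sigma>1 ''sp'' = sp"
          "reg \<sigma>1 ''E'' = E" "arr \<sigma>1 ''nxt'' = arr \<sigma> ''nxt''"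
          using p regs by (simp_all add: same_def out_regs_def out_arrs_def)
        have inp1: "inp I T \<sigma>1"
          using inp p(8) by (rule inp_same) (auto simp: out_regs_def out_arrs_def)
        have same1: "same fill_regs out_arrs \<sigma> \<sigma>1"
          using p(8) by (rule same_mono) (auto simp: fill_regs_def)
        have cls1: "arr \<sigma>1 ''cls'' j = real (cls I j)" using inp1 j by (simp add: inp_def)
        show ?thesis
        proof (cases xs)
          case Nil
          have F': "its = [?p]" "sp' = sp - r" "rest = []"
            using F False by (auto simp: x Nil)
          show ?thesis
            using r1 cls1 j W tl Nil
            apply (simp add: run_If not_less_both_iff del: of_nat_Suc)
            apply (rule run_fill_stop, simp)
            apply (rule Q)
            using p(7) apply (simp_all add: F' x stream_def same1 same_set_reg)
            apply (erule out_mono, simp)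
            done
        next
          case (Cons y ys)
          obtain j' r' where y: "y = (j', r')" by (cases y)
          have nx: "arr \<sigma> ''nxt'' j = real (Suc j')" "chain (arr \<sigma> ''nxt'') (arr \<sigma> ''nxt'' j') (map fst ys)"
            "r' = real (ptime I j')" "\<forall>x\<in>set ys. snd x = real (ptime I (fst x))"
            using tl by (auto simp: Cons y)
          have j': "j' < jobs I" "cls I j' < classes I" using val cl by (auto simp: Cons y)
          have inp': "arr \<sigma>1 ''cls'' j' = real (cls I j')" "arr \<sigma>1 ''t'' j' = real (ptime I j')"
            "arr \<sigma>1 ''s'' (cls I j') = real (stime I (cls I j'))"
            using inp1 j' by (simp_all add: inp_def)
          show ?thesis
          proof (cases "cls I j' = cls I j")
            case True
            have F': "fill I E (sp - r) xs = (tl its, sp', rest)" "its = ?p # tl its"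
              using F False True
              by (cases "fill I E (sp - r) xs"; auto simp: x y Cons)+
            show ?thesis
              using r1 cls1 j W nx j' inp' True
              apply (simp add: run_If not_less_both_iff del: of_nat_Suc)
              apply (rule Cons.IH[where sp = "sp - r" and M = "M @ [?p]" and its = "tl its" and b = b])
                          prefer 13
              subgoal for t \<sigma>2
                apply (rule Q)
                    apply (simp add: x Cons)
                   apply (subst F'(2), simp)
                  apply assumption
                 apply assumption
                apply (erule same_trans[rotated], simp add: same1 same_set_reg)
                done
              using p(7) val cl F'(1)
                         apply (simp_all add: inp1 stream_def Cons y same1 same_set_reg del: of_nat_Suc)
              apply (erule out_mono, simp)
              done
          next
            case neq: False
            show ?thesis
            proof (cases "sp - r < real (stime I (cls I j'))")
              case True
              have F': "its = [?p]" "sp' = sp - r" "rest = xs"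
                using F False True neq by (auto simp: x y Cons)
              show ?thesis
                using r1 cls1 j W nx j' inp' neq True
                apply (simp add: run_If not_less_both_iff del: of_nat_Suc)
                apply (rule run_fill_stop, simp)
                apply (rule Q)
                using p(7) apply (simp_all add: F' x y Cons stream_def same1 same_set_reg del: of_nat_Suc)
                apply (erule out_mono, simp)
                done
            next
              case fits: False
              let ?s = "Setup (cls I j') (E - (sp - r))"
              have F': "fill I E (sp - r - real (stime I (cls I j'))) xs = (tl (tl its), sp', rest)"
                "its = ?p # ?s # tl (tl its)"
                using F False fits neq
                by (cases "fill I E (sp - r - real (stime I (cls I j'))) xs"; auto simp: x y Cons)+
              show ?thesis
                apply (simp add: run_If not_less_both_iff r1 cls1 j less_imp_le[OF j] nx j' inp' neq fits
                    order_trans[OF less_imp_le W(1)] order_trans[OF less_imp_le W(2)] del: of_nat_Suc)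
                apply (rule run_emit[where x = ?s and i = "cls I j'" and cs = cs and k = k and M = "M @ [?p]" and b = "2 * length xs + 1 + b"])
                    prefer 5
                subgoal premises q for \<sigma>2
                proof -
                  have r2: "reg \<sigma>2 ''j'' = real (Suc j')" "reg \<sigma>2 ''rem'' = r'" "reg \<sigma>2 ''go'' = 1"
                    "reg \<sigma>2 ''sp'' = sp - r" "reg \<sigma>2 ''si'' = real (stime I (cls I j'))"
                    "reg \<sigma>2 ''E'' = E" "arr \<sigma>2 ''nxt'' = arr \<sigma> ''nxt''"
                    using q r1 nx by (simp_all add: same_def out_regs_def out_arrs_def del: of_nat_Suc)
                  have inp2: "inp I T \<sigma>2"
                    by (rule inp_same[OF _ q(2)]) (auto simp: out_regs_def out_arrs_def inp1)
                  have same2: "same fill_regs out_arrs \<sigma> \<sigma>2"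
                    by (rule same_trans[OF _ same_mono[OF q(2)]]) (simp_all add: same1 same_set_reg)
                  show ?thesis
                    apply (rule Cons.IH[where sp = "sp - r - real (stime I (cls I j'))"
                          and M = "M @ [?p, ?s]" and its = "tl (tl its)" and b = b])
                                prefer 13
                    subgoal for t \<sigma>3
                      apply (rule Q)
                          apply (simp add: x Cons)
                         apply (subst F'(2), simp)
                        apply assumption
                       apply assumption
                      apply (erule same_trans[rotated], simp add: same2 same_set_reg)
                      done
                    using q(1) val cl F'(1) r2 nx W
                               apply (simp_all add: inp2 stream_def Cons y del: of_nat_Suc)
                    done
                qed
                using p(7) by (simp_all add: r1 Cons del: of_nat_Suc)
            qed
          qed
        qed
      qed
      done
  qed
  then show ?case
    unfolding fill_com_def by (subst run_While) (simp add: regs)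
qed simp

section \<open>The loop that wraps a stream into fresh machines\<close>

definition block_body :: com where
  "block_body = seqs [
     Load ''ci'' ''cls'' (Minus (V ''j'') (N 1)), Load ''si'' ''s'' (V ''ci''),
     Floor ''k'' (Minus (N 0) (Divide (V ''rem'') (V ''cap''))),
     Assign ''k'' (Minus (Minus (N 0) (V ''k'')) (N 1)),
     new_group (V ''k''),
     emit 0 (V ''ci'') (Minus (Minus (V ''E'') (V ''cap'')) (V ''si'')) (N 0),
     emit 1 (Minus (V ''j'') (N 1)) (Minus (V ''E'') (V ''cap'')) (V ''cap''),
     Assign ''rem'' (Minus (V ''rem'') (Times (V ''k'') (V ''cap''))),
     new_group (N 1),
     emit 0 (V ''ci'') (Minus (Minus (V ''E'') (V ''cap'')) (V ''si'')) (N 0),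
     Assign ''sp'' (V ''cap''), Assign ''go'' (N 1), fill_com]"

definition block_com :: com where
  "block_com = While (Less (N 0) (V ''j'')) block_body"

definition block_regs :: "string set" where
  "block_regs = insert ''k'' fill_regs"

lemma block_regs_simps [simp]:
  "''j'' \<in> block_regs" "''rem'' \<in> block_regs" "''sp'' \<in> block_regs" "''go'' \<in> block_regs"
  "''ci'' \<in> block_regs" "''si'' \<in> block_regs" "''k'' \<in> block_regs"
  "out_regs \<subseteq> block_regs" "fill_regs \<subseteq> block_regs"
  by (auto simp: block_regs_def fill_regs_def)

text \<open>At least one job leaves the stream, so the fixed cost of a round is charged to it: two
  groups, three items, the extra item of \<open>fill_com\<close> and its two items per job make 8,
  and the steps stay below 150 per job.\<close>

lemma run_block_body:
  assumes blk: "block I E cap xs0 gs ((j, r) # xs) sp" and inp: "inp I T \<sigma>"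
    and strm: "stream I \<sigma> ''j'' ''rem'' ((j, r) # xs)"
    and cl: "\<forall>j<jobs I. cls I j < classes I" and W: "jobs I \<le> W" "classes I \<le> W"
    and cap: "0 < cap" and fits: "\<forall>x\<in>set xs0. real (stime I (cls I (fst x))) \<le> E - cap"
    and small: "\<forall>j<jobs I. real (ptime I j) / cap \<le> real W"
    and regs: "reg \<sigma> ''cap'' = cap" "reg \<sigma> ''E'' = E"
    and out: "out W (8 * length ((j, r) # xs) + b) \<sigma> (cs @ gs)"
    and Q: "\<And>t \<sigma>' gs' rest sp'. t + 1 + 150 * length rest \<le> 150 * length ((j, r) # xs) \<Longrightarrow>
      length rest < length ((j, r) # xs) \<Longrightarrow>
      out W (8 * length rest + b) \<sigma>' (cs @ gs') \<Longrightarrow> block I E cap xs0 gs' rest sp' \<Longrightarrow>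
      reg \<sigma>' ''sp'' = sp' \<Longrightarrow> stream I \<sigma>' ''j'' ''rem'' rest \<Longrightarrow>
      same block_regs out_arrs \<sigma> \<sigma>' \<Longrightarrow> Q t \<sigma>'"
  shows "run W block_body \<sigma> Q"
proof -
  define k where "k = nat (\<lceil>r / cap\<rceil> - 1)"
  have val: "j < jobs I" "0 < r" "r \<le> real (ptime I j)" "valid I xs"
    using blk by (auto simp: block_def)
  have "0 < r / cap" using val cap by simp
  then have k: "int k = \<lceil>r / cap\<rceil> - 1" unfolding k_def by simp
  then have kr: "real_of_int \<lceil>r / cap\<rceil> = real k + 1" by linarith
  have "r / cap \<le> real (ptime I j) / cap" using val cap by (intro divide_right_mono) auto
  \<comment> \<open>The side condition of \<open>Floor\<close>, in the form to which the simplifier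
    brings it; it holds since \<open>r\<close> is at most the full processing time.\<close>
  then have rW: "\<bar>r\<bar> / \<bar>cap\<bar> \<le> real W" using small val cap by force
  define su where "su = Setup (cls I j) (E - cap - real (stime I (cls I j)))"
  define ys where "ys = (j, r - real k * cap) # xs"
  define its sp' rest where "its = fst (fill I E cap ys)" and "sp' = fst (snd (fill I E cap ys))"
    and "rest = snd (snd (fill I E cap ys))"
  have F: "fill I E cap ys = (its, sp', rest)" by (simp add: its_def sp'_def rest_def)
  define gs' where "gs' = gs @ [(k, [su, Piece j (E - cap) cap]), (1, su # its)]"
  have blk': "block I E cap xs0 gs' rest sp'" and len: "length rest < length ((j, r) # xs)"
    and r': "0 < r - real k * cap"
    using block_step[OF blk cap cl fits k] by (simp_all add: su_def ys_def its_def sp'_def rest_def gs'_def)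
  have "0 \<le> real k * cap" using cap by simp
  then have "r - real k * cap \<le> real (ptime I j)" using val by linarith
  then have ysval: "valid I ys" using val r' by (simp add: ys_def)
  have regs: "reg \<sigma> ''j'' = real (Suc j)" "reg \<sigma> ''rem'' = r" "reg \<sigma> ''cap'' = cap" "reg \<sigma> ''E'' = E"
    and ch: "chain (arr \<sigma> ''nxt'') (arr \<sigma> ''nxt'' j) (map fst xs)" "\<forall>x\<in>set xs. snd x = real (ptime I (fst x))"
    using strm regs by (auto simp: stream_def)
  have ci: "arr \<sigma> ''cls'' j = real (cls I j)" "arr \<sigma> ''s'' (cls I j) = real (stime I (cls I j))"
    using inp val cl by (auto simp: inp_def)
  have W': "j \<le> W" "cls I j \<le> W" using val cl W by (auto intro: less_imp_le order.strict_trans2)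
  \<comment> \<open>The ceiling is computed as a negated floor: \<open>- real k - 1\<close> is the
    floor of \<open>- r / cap\<close>, and the second assignment turns it into
    \<open>k\<close>.\<close>
  define \<sigma>0 where "\<sigma>0 = set_reg ''k'' (real k) (set_reg ''k'' (- real k - 1)
    (set_reg ''si'' (real (stime I (cls I j))) (set_reg ''ci'' (real (cls I j)) \<sigma>)))"
  \<comment> \<open>What all output commands preserve; \<open>rem\<close> is tracked separately
    because it changes midway.\<close>
  define fixd where "fixd \<tau> \<longleftrightarrow> reg \<tau> ''j'' = real (Suc j) \<and> reg \<tau> ''cap'' = cap \<and> reg \<tau> ''E'' = E \<and>
    reg \<tau> ''ci'' = real (cls I j) \<and> reg \<tau> ''si'' = real (stime I (cls I j)) \<and> reg \<tau> ''k'' = real k \<and>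
    arr \<tau> ''nxt'' = arr \<sigma> ''nxt'' \<and> inp I T \<tau> \<and> same block_regs out_arrs \<sigma> \<tau>" for \<tau>
  have fixd0: "fixd \<sigma>0"
    using regs inp by (simp add: fixd_def \<sigma>0_def same_set_reg same_def)
  have fixd_step: "fixd \<tau>' \<and> reg \<tau>' ''rem'' = reg \<tau> ''rem''"
    if "fixd \<tau>" "same out_regs out_arrs \<tau> \<tau>'" for \<tau> \<tau>'
  proof -
    have "inp I T \<tau>'"
      using that by (intro inp_same[OF _ that(2)]) (auto simp: fixd_def out_regs_def out_arrs_def)
    moreover have "same block_regs out_arrs \<sigma> \<tau>'"
      using that by (intro same_trans[OF _ same_mono[OF that(2)]]) (auto simp: fixd_def)
    ultimately show ?thesis
      using that by (auto simp: fixd_def same_def out_regs_def out_arrs_def)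
  qed
  have "8 * length ((j, r) # xs) + b = Suc (Suc (Suc (Suc (Suc (8 * length xs + 3 + b)))))" by simp
  then have out0: "out W (Suc (Suc (Suc (Suc (Suc (8 * length xs + 3 + b)))))) \<sigma>0 (cs @ gs)"
    using out by (simp add: \<sigma>0_def add.assoc)
  let ?M = "[su, Piece j (E - cap) cap]"
  show ?thesis
    unfolding block_body_def
    apply (simp add: regs ci W' kr rW floor_minus del: of_nat_Suc)
    apply (fold \<sigma>0_def)
    apply (rule run_new_group[OF out0, of _ k])
     apply (simp add: \<sigma>0_def)
    subgoal premises q1 for \<sigma>1
    proof -
      have f1: "fixd \<sigma>1" "reg \<sigma>1 ''rem'' = r"
        using fixd_step[OF fixd0 q1(2)] regs by (simp_all add: \<sigma>0_def)
      show ?thesis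
        apply (rule run_emit[OF q1(1), where x = su and i = "cls I j"])
           apply (use f1 in \<open>simp_all add: fixd_def su_def\<close>)[3]
        subgoal premises q2 for \<sigma>2
        proof -
          have f2: "fixd \<sigma>2" "reg \<sigma>2 ''rem'' = r"
            using fixd_step[OF f1(1) q2(2)] f1 by simp_all
          show ?thesis
            apply (rule run_emit[OF q2(1), where x = "Piece j (E - cap) cap" and i = j])
               apply (use f2 in \<open>simp_all add: fixd_def\<close>)[3]
            subgoal premises q3 for \<sigma>3
            proof -
              have f3: "fixd \<sigma>3" "reg \<sigma>3 ''rem'' = r"
                using fixd_step[OF f2(1) q3(2)] f2 by simp_all
              define \<sigma>3' where "\<sigma>3' = set_reg ''rem'' (r - real k * cap) \<sigma>3"
              have f3': "fixd \<sigma>3'" "reg \<sigma>3' ''rem'' = r - real k * cap"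
                using f3 by (simp_all add: fixd_def \<sigma>3'_def same_set_reg)
              have o3: "out W (Suc (Suc (8 * length xs + 3 + b))) \<sigma>3' (cs @ gs @ [(k, ?M)])"
                using q3(1) by (simp add: \<sigma>3'_def)
              show ?thesis
                apply (simp add: f3[unfolded fixd_def])
                apply (fold \<sigma>3'_def)
                apply (rule run_new_group[OF o3, of _ 1])
                 apply simp
                subgoal premises q4 for \<sigma>4
                proof -
                  have f4: "fixd \<sigma>4" "reg \<sigma>4 ''rem'' = r - real k * cap"
                    using fixd_step[OF f3'(1) q4(2)] f3' by simp_all
                  have o4: "out W (Suc (8 * length xs + 3 + b)) \<sigma>4 ((cs @ gs @ [(k, ?M)]) @ [(1, [])])"
                    using q4(1) by simp
                  show ?thesis
                    apply (rule run_emit[OF o4, where x = su and i = "cls I j"])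
                       apply (use f4 in \<open>simp_all add: fixd_def su_def\<close>)[3]
                    subgoal premises q5 for \<sigma>5
                    proof -
                      have f5: "fixd \<sigma>5" "reg \<sigma>5 ''rem'' = r - real k * cap"
                        using fixd_step[OF f4(1) q5(2)] f4 by simp_all
                      define \<sigma>6 where "\<sigma>6 = set_reg ''go'' 1 (set_reg ''sp'' cap \<sigma>5)"
                      have f6: "fixd \<sigma>6" "reg \<sigma>6 ''rem'' = r - real k * cap" "reg \<sigma>6 ''go'' = 1" "reg \<sigma>6 ''sp'' = cap"
                        using f5 by (simp_all add: fixd_def \<sigma>6_def same_set_reg)
                      have o6: "out W (2 * length ys + 1 + (6 * length xs + b)) \<sigma>6 ((cs @ gs @ [(k, ?M)]) @ [(1, [su])])"
                        using q5(1) by (auto simp: \<sigma>6_def ys_def elim!: out_mono)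
                      have s6: "stream I \<sigma>6 ''j'' ''rem'' ys"
                        using f6 ch by (simp add: stream_def ys_def fixd_def)
                      show ?thesis
                        apply (simp add: f5[unfolded fixd_def])
                        apply (fold \<sigma>6_def)
                        apply (rule run_fill[where T = T, OF _ s6 _ ysval cl W f6(3,4) _ o6 F])
                           apply (use f6 in \<open>simp add: fixd_def\<close>)
                          apply (simp add: ys_def)
                         apply (use f6 in \<open>simp add: fixd_def\<close>)
                        subgoal premises q7 for t \<sigma>7
                        proof (rule Q[OF _ len _ blk' q7(4,3)])
                          show "37 + t + 1 + 150 * length rest \<le> 150 * length ((j, r) # xs)"
                            using q7(1) len by (simp add: ys_def)
                          show "out W (8 * length rest + b) \<sigma>7 (cs @ gs')"
                            using q7(2) len by (auto simp: gs'_def elim!: out_mono)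
                          show "same block_regs out_arrs \<sigma> \<sigma>7"
                            using f6(1) by (intro same_trans[OF _ same_mono[OF q7(5)]]) (auto simp: fixd_def)
                        qed
                        done
                    qed
                    done
                qed
                done
            qed
            done
        qed
        done
    qed
    done
qed

lemma run_block:
  assumes "block I E cap xs0 gs xs sp" "inp I T \<sigma>" "stream I \<sigma> ''j'' ''rem'' xs"
    and "\<forall>j<jobs I. cls I j < classes I" "jobs I \<le> W" "classes I \<le> W"
    and "0 < cap" "\<forall>x\<in>set xs0. real (stime I (cls I (fst x))) \<le> E - cap"
    and "\<forall>j<jobs I. real (ptime I j) / cap \<le> real W"
    and "reg \<sigma> ''cap'' = cap" "reg \<sigma> ''E'' = E" "reg \<sigma> ''sp'' = sp"
    and "out W (8 * length xs + b) \<sigma> (cs @ gs)"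
    and "\<And>t \<sigma>' gs' sp'. t \<le> 150 * length xs + 1 \<Longrightarrow> out W b \<sigma>' (cs @ gs') \<Longrightarrow>
      block I E cap xs0 gs' [] sp' \<Longrightarrow> reg \<sigma>' ''sp'' = sp' \<Longrightarrow>
      same block_regs out_arrs \<sigma> \<sigma>' \<Longrightarrow> Q t \<sigma>'"
  shows "run W block_com \<sigma> Q"
  using assms
proof (induction "length xs" arbitrary: xs gs sp \<sigma> Q rule: less_induct)
  case less
  note prems = less.prems
  show ?case
  proof (cases xs)
    case Nil
    have "reg \<sigma> ''j'' = 0" using prems(3) by (simp add: stream_def Nil)
    moreover have "Q 1 \<sigma>"
      using prems by (intro prems(14)[where gs' = gs and sp' = sp]) (simp_all add: Nil same_def)
    ultimately show ?thesis unfolding block_com_def by (subst run_While) simp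
  next
    case (Cons x ys)
    obtain j r where x: "x = (j, r)" by (cases x)
    have "reg \<sigma> ''j'' = real (Suc j)" using prems(3) by (simp add: stream_def Cons x)
    moreover have "run W block_body \<sigma> (\<lambda>k \<sigma>'. run W block_com \<sigma>' (\<lambda>k'. Q (1 + k + k')))"
    proof (rule run_block_body[OF prems(1-3)[unfolded Cons x] prems(4-11) prems(13)[unfolded Cons x]])
      fix t \<sigma>' gs' rest sp'
      assume t: "t + 1 + 150 * length rest \<le> 150 * length ((j, r) # ys)"
        and len: "length rest < length ((j, r) # ys)"
        and new: "out W (8 * length rest + b) \<sigma>' (cs @ gs')" "block I E cap xs0 gs' rest sp'"
          "reg \<sigma>' ''sp'' = sp'" "stream I \<sigma>' ''j'' ''rem'' rest"
        and same: "same block_regs out_arrs \<sigma> \<sigma>'"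
      have "inp I T \<sigma>'"
        by (rule inp_same[OF prems(2) same]) (auto simp: block_regs_def fill_regs_def out_regs_def out_arrs_def)
      moreover have "reg \<sigma>' ''cap'' = cap" "reg \<sigma>' ''E'' = E"
        using same prems(10,11) by (simp_all add: same_def block_regs_def fill_regs_def out_regs_def)
      ultimately show "run W block_com \<sigma>' (\<lambda>k'. Q (1 + t + k'))"
        using len t
        by (intro less.hyps[OF _ new(2) _ new(4) prems(4-9) _ _ new(3,1)] prems(14) same_trans[OF same])
          (auto simp: Cons x)
    qed
    ultimately show ?thesis unfolding block_com_def by (subst run_While) simp
  qed
qed

subsection \<open>Linking the jobs\<close>

lemma chain_upd: "chain nx h js \<Longrightarrow> n \<notin> set js \<Longrightarrow> chain (nx(n := v)) h js"
  by (induction js arbitrary: h) auto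

lemma chain_pos: "chain nx h js \<Longrightarrow> 0 < h \<longleftrightarrow> js \<noteq> []"
  by (cases js) auto

text \<open>Only the pointer of the last element changes, so joining takes constant time;
  distinctness keeps the other pointers intact.\<close>

lemma chain_append:
  "chain nx h js \<Longrightarrow> js \<noteq> [] \<Longrightarrow> distinct (js @ js') \<Longrightarrow> chain nx h' js' \<Longrightarrow>
    chain (nx(last js := h')) h (js @ js')"
proof (induction js arbitrary: h)
  case (Cons j js)
  then show ?case
    using chain_upd[of nx h' js' j h'] by (cases "js = []") (auto simp: fun_upd_def)
qed simp

definition linked :: "inst \<Rightarrow> nat \<Rightarrow> state \<Rightarrow> nat \<Rightarrow> bool" where
  "linked I n \<sigma> i \<longleftrightarrow> chain (arr \<sigma> ''nxt'') (arr \<sigma> ''head'' i) (jobs_upto I n i) \<and>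
     (jobs_upto I n i \<noteq> [] \<longrightarrow> arr \<sigma> ''tail'' i = real (last (jobs_upto I n i)))"

definition link_body :: com where
  "link_body = seqs [
     Load ''ci'' ''cls'' (V ''i''), Load ''h'' ''head'' (V ''ci''),
     If (Less (N 0) (V ''h'')) SKIP (Store ''tail'' (V ''ci'') (V ''i'')),
     Store ''nxt'' (V ''i'') (V ''h''), Store ''head'' (V ''ci'') (Plus (V ''i'') (N 1)),
     Assign ''i'' (Plus (V ''i'') (N 1))]"

definition link_regs :: "string set" where "link_regs = {''i'', ''ci'', ''h'', ''e'', ''si'', ''cj''}"
definition link_arrs :: "string set" where "link_arrs = {''head'', ''tail'', ''nxt''}"

text \<open>\<open>cj\<close> belongs to the common frame \<open>link_regs\<close> of both linking
  loops, hence the separate claim that this loop keeps it; the next loop starts from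
  \<open>cj = 0\<close>.\<close>

lemma run_link:
  assumes inp: "inp I T \<sigma>" and cl: "\<forall>j<jobs I. cls I j < classes I" and W: "jobs I \<le> W" "classes I \<le> W"
    and init: "reg \<sigma> ''i'' = 0" "\<forall>i. arr \<sigma> ''head'' i = 0"
    and Q: "\<And>t \<sigma>'. t \<le> 10 * jobs I + 1 \<Longrightarrow> \<forall>i<classes I. linked I (jobs I) \<sigma>' i \<Longrightarrow>
      same link_regs link_arrs \<sigma> \<sigma>' \<Longrightarrow> reg \<sigma>' ''cj'' = reg \<sigma> ''cj'' \<Longrightarrow> Q t \<sigma>'"
  shows "run W (While (Less (V ''i'') (V ''n'')) link_body) \<sigma> Q"
proof (rule run_While_potential[where f = "10 * jobs I" and
      Inv = "\<lambda>f \<tau>. \<exists>k\<le>jobs I. f = 10 * (jobs I - k) \<and> reg \<tau> ''i'' = real k \<and>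
        (\<forall>i<classes I. linked I k \<tau> i) \<and> same link_regs link_arrs \<sigma> \<tau> \<and> reg \<tau> ''cj'' = reg \<sigma> ''cj''"])
  show "\<exists>k\<le>jobs I. 10 * jobs I = 10 * (jobs I - k) \<and> reg \<sigma> ''i'' = real k \<and>
      (\<forall>i<classes I. linked I k \<sigma> i) \<and> same link_regs link_arrs \<sigma> \<sigma> \<and> reg \<sigma> ''cj'' = reg \<sigma> ''cj''"
    using init by (intro exI[of _ 0]) (auto simp: linked_def same_def)
next
  fix f \<tau>
  assume "\<exists>k\<le>jobs I. f = 10 * (jobs I - k) \<and> reg \<tau> ''i'' = real k \<and>
      (\<forall>i<classes I. linked I k \<tau> i) \<and> same link_regs link_arrs \<sigma> \<tau> \<and> reg \<tau> ''cj'' = reg \<sigma> ''cj''"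
    and b: "bval (Less (V ''i'') (V ''n'')) \<tau>"
  then obtain k where k: "k \<le> jobs I" "f = 10 * (jobs I - k)" "reg \<tau> ''i'' = real k"
    and lk: "\<forall>i<classes I. linked I k \<tau> i" and same: "same link_regs link_arrs \<sigma> \<tau>"
    and cj: "reg \<tau> ''cj'' = reg \<sigma> ''cj''" by blast
  have inp': "inp I T \<tau>" by (rule inp_same[OF inp same]) (auto simp: link_regs_def link_arrs_def)
  have lt: "k < jobs I" using b k inp' by (simp add: inp_def)
  define i where "i = cls I k"
  have i: "i < classes I" "arr \<tau> ''cls'' k = real i" "i \<le> W" "k \<le> W"
    using inp' lt cl W by (auto simp: inp_def i_def intro: less_imp_le order.strict_trans2)
  define h where "h = arr \<tau> ''head'' i"
  have h: "0 < h \<longleftrightarrow> jobs_upto I k i \<noteq> []" using lk i chain_pos by (auto simp: linked_def h_def)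
  define \<tau>1 where "\<tau>1 = set_reg ''h'' h (set_reg ''ci'' (real i) \<tau>)"
  define \<tau>2 where "\<tau>2 = (if 0 < h then \<tau>1 else set_cell ''tail'' i (real k) \<tau>1)"
  define \<tau>3 where "\<tau>3 = set_reg ''i'' (real (Suc k)) (set_cell ''head'' i (real (Suc k)) (set_cell ''nxt'' k h \<tau>2))"
  have "linked I (Suc k) \<tau>3 i'" if "i' < classes I" for i'
  proof -
    have "linked I k \<tau> i'" using lk that by blast
    moreover have "k \<notin> set (jobs_upto I k i')" by (simp add: set_jobs_upto)
    ultimately show ?thesis
      using h by (auto simp: linked_def \<tau>3_def \<tau>2_def \<tau>1_def h_def i_def[symmetric] chain_upd simp del: of_nat_Suc)
  qed
  moreover have "same link_regs link_arrs \<sigma> \<tau>3"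
    using same by (auto simp: same_def \<tau>3_def \<tau>2_def \<tau>1_def link_regs_def link_arrs_def)
  moreover have "reg \<tau>3 ''i'' = real (Suc k)" "reg \<tau>3 ''cj'' = reg \<sigma> ''cj''"
    using cj by (simp_all add: \<tau>3_def \<tau>2_def \<tau>1_def)
  ultimately have post: "\<exists>f'. (\<exists>k\<le>jobs I. f' = 10 * (jobs I - k) \<and> reg \<tau>3 ''i'' = real k \<and>
        (\<forall>i<classes I. linked I k \<tau>3 i) \<and> same link_regs link_arrs \<sigma> \<tau>3 \<and> reg \<tau>3 ''cj'' = reg \<sigma> ''cj'')
        \<and> 8 + 1 + f' \<le> f"
    using lt k by (intro exI[of _ "10 * (jobs I - Suc k)"] conjI exI[of _ "Suc k"]) auto
  have "run W link_body \<tau> (\<lambda>t \<sigma>'. t \<le> 8 \<and> \<sigma>' = \<tau>3)"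
    by (cases "0 < h") (simp_all add: link_body_def run_If k i h_def[symmetric] \<tau>3_def \<tau>2_def \<tau>1_def add.commute[of _ 1])
  then show "run W link_body \<tau> (\<lambda>t \<sigma>'. \<exists>f'. (\<exists>k\<le>jobs I. f' = 10 * (jobs I - k) \<and> reg \<sigma>' ''i'' = real k \<and>
        (\<forall>i<classes I. linked I k \<sigma>' i) \<and> same link_regs link_arrs \<sigma> \<sigma>' \<and> reg \<sigma>' ''cj'' = reg \<sigma> ''cj'')
        \<and> t + 1 + f' \<le> f)"
    by (rule run_mono) (use post in force)
next
  fix f' \<tau> t
  assume "\<exists>k\<le>jobs I. f' = 10 * (jobs I - k) \<and> reg \<tau> ''i'' = real k \<and>
      (\<forall>i<classes I. linked I k \<tau> i) \<and> same link_regs link_arrs \<sigma> \<tau> \<and> reg \<tau> ''cj'' = reg \<sigma> ''cj''"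
    and b: "\<not> bval (Less (V ''i'') (V ''n'')) \<tau>" and t: "t + f' \<le> 10 * jobs I + 1"
  then obtain k where k: "k \<le> jobs I" "reg \<tau> ''i'' = real k"
    and lk: "\<forall>i<classes I. linked I k \<tau> i" and same: "same link_regs link_arrs \<sigma> \<tau>"
    and cj: "reg \<tau> ''cj'' = reg \<sigma> ''cj''" by blast
  have "inp I T \<tau>" by (rule inp_same[OF inp same]) (auto simp: link_regs_def link_arrs_def)
  then have "k = jobs I" using b k by (simp add: inp_def)
  then show "Q t \<tau>" using lk same cj t by (intro Q) auto
qed

definition concat_body :: com where
  "concat_body = seqs [
     Load ''si'' ''s'' (V ''i''),
     If (Less (V ''T'') (Plus (V ''si'') (V ''si''))) SKIP
       (seqs [Load ''h'' ''head'' (V ''i''), Load ''e'' ''tail'' (V ''i''),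
              Store ''nxt'' (V ''e'') (V ''cj''), Assign ''cj'' (V ''h'')]),
     Assign ''i'' (Plus (V ''i'') (N 1))]"

text \<open>Joining redirects the end pointer of a cheap class, whose list may then run on into
  others. So \<open>linked\<close> is claimed only for classes not yet reached and for the expensive
  ones, whose lists stay separate.\<close>

definition concatenated :: "inst \<Rightarrow> real \<Rightarrow> nat \<Rightarrow> state \<Rightarrow> bool" where
  "concatenated I T k \<sigma> \<longleftrightarrow> chain (arr \<sigma> ''nxt'') (reg \<sigma> ''cj'') (cheap_list I T k) \<and>
     (\<forall>i<classes I. k \<le> i \<or> T / 2 < real (stime I i) \<longrightarrow> linked I (jobs I) \<sigma> i)"

lemma run_concat:
  assumes inp: "inp I T \<sigma>" and cl: "\<forall>i<classes I. class_list I i \<noteq> []" and W: "jobs I \<le> W" "classes I \<le> W"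
    and init: "reg \<sigma> ''i'' = 0" "reg \<sigma> ''cj'' = 0" "\<forall>i<classes I. linked I (jobs I) \<sigma> i"
    and Q: "\<And>t \<sigma>'. t \<le> 12 * classes I + 1 \<Longrightarrow> concatenated I T (classes I) \<sigma>' \<Longrightarrow>
      same link_regs link_arrs \<sigma> \<sigma>' \<Longrightarrow> Q t \<sigma>'"
  shows "run W (While (Less (V ''i'') (V ''c'')) concat_body) \<sigma> Q"
proof (rule run_While_potential[where f = "12 * classes I" and
      Inv = "\<lambda>f \<tau>. \<exists>k\<le>classes I. f = 12 * (classes I - k) \<and> reg \<tau> ''i'' = real k \<and>
        concatenated I T k \<tau> \<and> same link_regs link_arrs \<sigma> \<tau>"])
  show "\<exists>k\<le>classes I. 12 * classes I = 12 * (classes I - k) \<and> reg \<sigma> ''i'' = real k \<and>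
      concatenated I T k \<sigma> \<and> same link_regs link_arrs \<sigma> \<sigma>"
    using init by (intro exI[of _ 0]) (auto simp: concatenated_def same_def)
next
  fix f \<tau>
  assume "\<exists>k\<le>classes I. f = 12 * (classes I - k) \<and> reg \<tau> ''i'' = real k \<and>
      concatenated I T k \<tau> \<and> same link_regs link_arrs \<sigma> \<tau>"
    and b: "bval (Less (V ''i'') (V ''c'')) \<tau>"
  then obtain k where k: "k \<le> classes I" "f = 12 * (classes I - k)" "reg \<tau> ''i'' = real k"
    and con: "concatenated I T k \<tau>" and same: "same link_regs link_arrs \<sigma> \<tau>" by blast
  have inp': "inp I T \<tau>" by (rule inp_same[OF inp same]) (auto simp: link_regs_def link_arrs_def)
  have lt: "k < classes I" "k \<le> W" using b k inp' W by (simp_all add: inp_def)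
  have s: "arr \<tau> ''s'' k = real (stime I k)" "reg \<tau> ''T'' = T" using inp' lt by (simp_all add: inp_def)
  let ?L = "class_list I k"
  have L: "?L \<noteq> []" "chain (arr \<tau> ''nxt'') (arr \<tau> ''head'' k) ?L" "arr \<tau> ''tail'' k = real (last ?L)"
    using con lt cl by (auto simp: concatenated_def linked_def)
  have "last ?L \<in> set ?L" using L by simp
  then have lst: "last ?L < jobs I" "cls I (last ?L) = k" by (simp_all add: set_jobs_upto)
  then have lW: "last ?L \<le> W" using W by linarith
  define \<tau>1 where "\<tau>1 = set_reg ''cj'' (arr \<tau> ''head'' k) (set_cell ''nxt'' (last ?L) (reg \<tau> ''cj'')
    (set_reg ''e'' (real (last ?L)) (set_reg ''h'' (arr \<tau> ''head'' k) (set_reg ''si'' (real (stime I k)) \<tau>))))"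
  define \<tau>2 where "\<tau>2 = set_reg ''i'' (real (Suc k))
    (if T < 2 * real (stime I k) then set_reg ''si'' (real (stime I k)) \<tau> else \<tau>1)"
  have "concatenated I T (Suc k) \<tau>2"
  proof (cases "T < 2 * real (stime I k)")
    case True
    then show ?thesis using con by (auto simp: \<tau>2_def concatenated_def linked_def)
  next
    case False
    have "distinct (?L @ cheap_list I T k)"
      by (auto simp: distinct_cheap_list set_cheap_list set_jobs_upto)
    then have "chain ((arr \<tau> ''nxt'')(last ?L := reg \<tau> ''cj'')) (arr \<tau> ''head'' k) (?L @ cheap_list I T k)"
      using L con by (intro chain_append) (auto simp: concatenated_def)
    moreover have "linked I (jobs I) \<tau>1 i" if "i < classes I" "linked I (jobs I) \<tau> i" "k < i \<or> T / 2 < real (stime I i)" for i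
      using that lst False by (auto simp: linked_def \<tau>1_def set_jobs_upto intro!: chain_upd)
    ultimately show ?thesis
      using False con by (auto simp: \<tau>2_def \<tau>1_def concatenated_def linked_def Suc_le_eq)
  qed
  moreover have "same link_regs link_arrs \<sigma> \<tau>2"
    using same by (auto simp: same_def \<tau>2_def \<tau>1_def link_regs_def link_arrs_def)
  moreover have "reg \<tau>2 ''i'' = real (Suc k)" by (simp add: \<tau>2_def)
  ultimately have post: "\<exists>f'. (\<exists>k\<le>classes I. f' = 12 * (classes I - k) \<and> reg \<tau>2 ''i'' = real k \<and>
        concatenated I T k \<tau>2 \<and> same link_regs link_arrs \<sigma> \<tau>2) \<and> 10 + 1 + f' \<le> f"
    using lt k by (intro exI[of _ "12 * (classes I - Suc k)"] conjI exI[of _ "Suc k"]) auto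
  have "run W concat_body \<tau> (\<lambda>t \<sigma>'. t \<le> 10 \<and> \<sigma>' = \<tau>2)"
    using lt lW L s k
    by (cases "T < 2 * real (stime I k)")
      (simp_all add: concat_body_def run_If \<tau>2_def \<tau>1_def add.commute[of _ 1])
  then show "run W concat_body \<tau> (\<lambda>t \<sigma>'. \<exists>f'. (\<exists>k\<le>classes I. f' = 12 * (classes I - k) \<and> reg \<sigma>' ''i'' = real k \<and>
        concatenated I T k \<sigma>' \<and> same link_regs link_arrs \<sigma> \<sigma>') \<and> t + 1 + f' \<le> f)"
    by (rule run_mono) (use post in force)
next
  fix f' \<tau> t
  assume "\<exists>k\<le>classes I. f' = 12 * (classes I - k) \<and> reg \<tau> ''i'' = real k \<and>
      concatenated I T k \<tau> \<and> same link_regs link_arrs \<sigma> \<tau>"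
    and b: "\<not> bval (Less (V ''i'') (V ''c'')) \<tau>" and t: "t + f' \<le> 12 * classes I + 1"
  then obtain k where k: "k \<le> classes I" "reg \<tau> ''i'' = real k"
    and con: "concatenated I T k \<tau>" and same: "same link_regs link_arrs \<sigma> \<tau>" by blast
  have "inp I T \<tau>" by (rule inp_same[OF inp same]) (auto simp: link_regs_def link_arrs_def)
  then have "k = classes I" using b k by (simp add: inp_def)
  then show "Q t \<tau>" using con same t by (intro Q) auto
qed

subsection \<open>Scheduling the expensive classes\<close>

text \<open>The cheap stream is parked in \<open>cj\<close> and \<open>crem\<close> while
  \<open>j\<close> and \<open>rem\<close> run through class \<open>i\<close>. With
  \<open>E = si + cap\<close> the setup starts at time 0. \<open>si\<close> is loaded again because
  the wrapping overwrites it.\<close>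

definition main_body :: com where
  "main_body = seqs [
     Load ''si'' ''s'' (V ''i''),
     If (Less (V ''T'') (Plus (V ''si'') (V ''si'')))
       (seqs [
          Load ''j'' ''head'' (V ''i''), Load ''rem'' ''t'' (Minus (V ''j'') (N 1)),
          Assign ''cap'' (Divide (V ''T'') (N 2)), Assign ''E'' (Plus (V ''si'') (V ''cap'')),
          block_com,
          Load ''si'' ''s'' (V ''i''),
          Assign ''gap'' (Plus (Minus (V ''cap'') (V ''si'')) (V ''sp'')),
          If (And (Less (N 0) (V ''gap'')) (Less (N 0) (V ''cj'')))
            (seqs [
               Assign ''j'' (V ''cj''), Assign ''rem'' (V ''crem''),
               Load ''ci'' ''cls'' (Minus (V ''j'') (N 1)), Load ''si'' ''s'' (V ''ci''),
               Assign ''E'' (Divide (Times (N 3) (V ''T'')) (N 2)),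
               emit 0 (V ''ci'') (Minus (Minus (V ''E'') (V ''gap'')) (V ''si'')) (N 0),
               Assign ''sp'' (V ''gap''), Assign ''go'' (N 1), fill_com,
               Assign ''cj'' (V ''j''), Assign ''crem'' (V ''rem'')])
            SKIP])
       SKIP,
     Assign ''i'' (Plus (V ''i'') (N 1))]"

definition jobs_from :: "inst \<Rightarrow> nat \<Rightarrow> nat" where
  "jobs_from I i = (\<Sum>i'\<in>{i..<classes I}. length (class_list I i'))"

text \<open>The reserve has 8 units per job for wrapping it into fresh machines, 2 more per job of a
  pending class for the work in its gap, and 1 for the padding group. Chains are claimed for
  expensive classes only, as the lists of cheap ones have been joined.\<close>

definition main_inv :: "inst \<Rightarrow> real \<Rightarrow> nat \<Rightarrow> state \<Rightarrow> nat \<Rightarrow> csched \<Rightarrow> (nat \<times> real) list \<Rightarrow> bool" where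
  "main_inv I T W \<sigma> i cs ys \<longleftrightarrow> i \<le> classes I \<and> reg \<sigma> ''i'' = real i \<and> inp I T \<sigma> \<and>
     stream I \<sigma> ''cj'' ''crem'' ys \<and> progress I T i cs ys \<and>
     out W (10 * jobs_from I i + 8 * length ys + 1) \<sigma> cs \<and>
     (\<forall>i'<classes I. T / 2 < real (stime I i') \<longrightarrow>
        chain (arr \<sigma> ''nxt'') (arr \<sigma> ''head'' i') (class_list I i'))"

lemma jobs_from_step: "i < classes I \<Longrightarrow> jobs_from I i = length (class_list I i) + jobs_from I (Suc i)"
  by (simp add: jobs_from_def sum.atLeast_Suc_lessThan)

lemma class_list_nonempty: "wf_inst I \<Longrightarrow> i < classes I \<Longrightarrow> class_list I i \<noteq> []"
proof -
  assume "wf_inst I" "i < classes I"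
  then obtain j where "j \<in> class_jobs I i" by (auto simp: wf_inst_def)
  then have "j \<in> set (class_list I i)" by (simp add: set_jobs_upto class_jobs_def)
  then show ?thesis by auto
qed

text \<open>Classes are nonempty, so the constant overhead of a round, including the last round of
  \<open>fill_com\<close>, is charged to the jobs of class \<open>i\<close>. Each cheap job consumed
  in the gap pays with its own 100.\<close>

lemma run_main_body:
  assumes wf: "wf_inst I" and T: "0 < T" and sT: "\<forall>i<classes I. real (stime I i) \<le> T"
    and W: "jobs I \<le> W" "classes I \<le> W" and small: "\<forall>j<jobs I. real (ptime I j) / (T / 2) \<le> real W"
    and inv: "main_inv I T W \<sigma> i cs ys" and i: "i < classes I"
    and Q: "\<And>t \<sigma>' cs' ys'. main_inv I T W \<sigma>' (Suc i) cs' ys' \<Longrightarrow>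
      t + 1 + 300 * jobs_from I (Suc i) + 100 * length ys' \<le> 300 * jobs_from I i + 100 * length ys \<Longrightarrow> Q t \<sigma>'"
  shows "run W main_body \<sigma> Q"
proof -
  let ?L = "class_list I i"
  define \<phi> where "\<phi> = jobs_from I (Suc i)"
  have \<phi>: "jobs_from I i = length ?L + \<phi>" using jobs_from_step[OF i] by (simp add: \<phi>_def)
  have L: "?L \<noteq> []" using class_list_nonempty[OF wf i] .
  then have L1: "1 \<le> length ?L" by (cases ?L) auto
  have cl: "\<forall>j<jobs I. cls I j < classes I" using wf by (auto simp: wf_inst_def)
  have ri: "reg \<sigma> ''i'' = real i" and inp: "inp I T \<sigma>" and strm: "stream I \<sigma> ''cj'' ''crem'' ys"
    and prog: "progress I T i cs ys" and out: "out W (10 * jobs_from I i + 8 * length ys + 1) \<sigma> cs"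
    and ch: "\<And>i'. i' < classes I \<Longrightarrow> T / 2 < real (stime I i') \<Longrightarrow>
       chain (arr \<sigma> ''nxt'') (arr \<sigma> ''head'' i') (class_list I i')"
    using inv by (auto simp: main_inv_def)
  have si: "arr \<sigma> ''s'' i = real (stime I i)" "i \<le> W" "reg \<sigma> ''T'' = T"
    using inp i W by (auto simp: inp_def)
  show ?thesis
  proof (cases "T / 2 < real (stime I i)")
    case False
    define \<sigma>1 where "\<sigma>1 = set_reg ''i'' (real (Suc i)) (set_reg ''si'' (real (stime I i)) \<sigma>)"
    have "main_inv I T W \<sigma>1 (Suc i) cs ys"
      using inv progress_cheap[OF prog i] False i out_mono[OF out, of "10 * \<phi> + 8 * length ys + 1"] \<phi>
      by (simp add: main_inv_def \<sigma>1_def \<phi>_def stream_def)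
    then have "Q 5 \<sigma>1" using \<phi> L1 by (intro Q) (auto simp: \<phi>_def)
    then show ?thesis using False si ri
      by (simp add: main_body_def run_If \<sigma>1_def add.commute[of _ 1] numeral_eq_Suc)
  next
    case True
    have True': "T < 2 * real (stime I i)" using True by simp
    obtain j js where js: "?L = j # js" using L by (cases ?L) auto
    have "j \<in> set ?L" by (simp add: js)
    then have j: "j < jobs I" "j \<le> W" using W by (auto simp: set_jobs_upto)
    have hd: "arr \<sigma> ''head'' i = real (Suc j)" and tj: "arr \<sigma> ''t'' j = real (ptime I j)"
      using ch[OF i True] inp j by (simp_all add: js inp_def)
    define s where "s = real (stime I i)"
    define \<sigma>1 where "\<sigma>1 = set_reg ''E'' (s + T / 2) (set_reg ''cap'' (T / 2)
      (set_reg ''rem'' (real (ptime I j)) (set_reg ''j'' (real (Suc j)) (set_reg ''si'' s \<sigma>))))"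
    have valid: "valid I (whole I ?L)" using wf by (intro valid_whole) (auto simp: set_jobs_upto)
    have blk0: "block I (s + T / 2) (T / 2) (whole I ?L) [] (whole I ?L) (reg \<sigma>1 ''sp'')"
      using L by (intro block_init valid) simp
    have strm1: "stream I \<sigma>1 ''j'' ''rem'' (whole I ?L)"
      using ch[OF i True] hd unfolding stream_def
      by (simp add: \<sigma>1_def js) (simp add: whole_def)
    have fits: "\<forall>x\<in>set (whole I ?L). real (stime I (cls I (fst x))) \<le> s + T / 2 - T / 2"
      by (simp add: whole_def set_jobs_upto s_def)
    have out1: "out W (8 * length (whole I ?L) + (2 * length ?L + 10 * \<phi> + 8 * length ys + 1)) \<sigma>1 (cs @ [])"
      using out \<phi> by (auto simp: \<sigma>1_def elim!: out_mono)
    have inp1: "inp I T \<sigma>1" using inp by (simp add: \<sigma>1_def)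
    have iexp: "i \<in> I_exp I T" using i True by (simp add: I_exp_def)
    show ?thesis
      unfolding main_body_def
      apply (simp add: run_If si ri True' hd j tj del: of_nat_Suc)
      apply (fold s_def)
      apply (fold \<sigma>1_def)
      apply (rule run_block[OF blk0 inp1 strm1 cl W _ fits small _ _ refl out1])
         apply (use T in \<open>simp_all add: \<sigma>1_def\<close>)[3]
      subgoal premises q for t \<sigma>2 gs sp
      proof -
        have same: "reg \<sigma>2 ''cj'' = reg \<sigma> ''cj''" "reg \<sigma>2 ''crem'' = reg \<sigma> ''crem''" "reg \<sigma>2 ''i'' = real i"
          "reg \<sigma>2 ''T'' = T" "reg \<sigma>2 ''cap'' = T / 2" "arr \<sigma>2 ''nxt'' = arr \<sigma> ''nxt''"
          "arr \<sigma>2 ''head'' = arr \<sigma> ''head''" "reg \<sigma>2 ''sp'' = sp"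
          using q(4,5) si ri by (simp_all add: same_def \<sigma>1_def block_regs_def fill_regs_def out_regs_def out_arrs_def)
        have inp2: "inp I T \<sigma>2"
          by (rule inp_same[OF inp1 q(5)]) (auto simp: block_regs_def fill_regs_def out_regs_def out_arrs_def)
        have s2: "arr \<sigma>2 ''s'' i = s" using inp2 i by (simp add: inp_def s_def)
        have strm2: "stream I \<sigma>2 ''cj'' ''crem'' ys" using strm same by (simp add: stream_def)
        have blk: "block I (real (stime I i) + T / 2) (T / 2) (whole I ?L) gs [] sp"
          using q(3) by (simp add: s_def)
        have sT': "real (stime I i) \<le> T" using sT i by blast
        define gap where "gap = T / 2 - s + sp"
        note exp = progress_expensive[OF prog iexp T wf sT' blk, folded s_def, folded gap_def]
        define \<sigma>3 where "\<sigma>3 = set_reg ''gap'' gap (set_reg ''si'' s \<sigma>2)"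
        have pos: "0 < reg \<sigma> ''cj'' \<longleftrightarrow> ys \<noteq> []"
          using strm chain_pos[of "arr \<sigma> ''nxt''" "reg \<sigma> ''cj''" "map fst ys"] by (simp add: stream_def)
        show ?thesis
        proof (cases "ys = [] \<or> gap \<le> 0")
          case stop: True
          have c: "\<not> (0 < gap \<and> 0 < reg \<sigma> ''cj'')" using stop pos by auto
          have prog': "progress I T (Suc i) (cs @ gs) ys" using exp(1) stop by simp
          define \<sigma>4 where "\<sigma>4 = set_reg ''i'' (real (Suc i)) \<sigma>3"
          have "out W (10 * \<phi> + 8 * length ys + 1) \<sigma>4 (cs @ gs)"
            using q(2) by (auto simp: \<sigma>4_def \<sigma>3_def elim: out_mono)
          then have "main_inv I T W \<sigma>4 (Suc i) (cs @ gs) ys"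
            using i prog' strm2 inp2 ch same
            by (simp add: main_inv_def \<sigma>4_def \<sigma>3_def \<phi>_def stream_def)
          moreover have "t + 20 + 1 + 300 * \<phi> \<le> 300 * jobs_from I i" using q(1) \<phi> L1 by simp
          ultimately have Q': "k \<le> t + 20 \<Longrightarrow> Q k \<sigma>4" for k by (intro Q) (auto simp: \<phi>_def)
          show ?thesis
            apply (rule exI[of _ i])
            using c Q'[unfolded \<sigma>4_def \<sigma>3_def]
            by (auto simp: same s2 si gap_def[symmetric] add.commute[of _ 1])
        next
          case go: False
          then obtain y z ys1 where ys: "ys = (y, z) # ys1" and gap: "0 < gap" by (cases ys) auto
          have val: "valid I ys" using prog by (simp add: progress_def)
          then have y: "y < jobs I" "y \<le> W" "cls I y < classes I" "cls I y \<le> W"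
            using cl W by (auto simp: ys intro: less_imp_le order.strict_trans2)
          have cj: "reg \<sigma> ''cj'' = real (Suc y)" "reg \<sigma> ''crem'' = z"
            using strm by (simp_all add: stream_def ys)
          define s' where "s' = real (stime I (cls I y))"
          have inp': "arr \<sigma>2 ''cls'' y = real (cls I y)" "arr \<sigma>2 ''s'' (cls I y) = s'"
            using inp2 y by (simp_all add: inp_def s'_def)
          obtain gs0 M where gs: "gs = gs0 @ [(1, M)]" using blk by (auto simp: block_def)
          obtain its sp2 zs where F: "fill I (3 / 2 * T) gap ys = (its, sp2, zs)"
            by (metis prod_cases3)
          have zs: "length zs \<le> length ys" using fill_rest_le[of I "3 / 2 * T" gap ys] F by simp
          define su where "su = Setup (cls I y) (3 / 2 * T - gap - s')"
          have prog': "progress I T (Suc i) (cs @ gs0 @ [(1, M @ su # its)]) zs"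
            using exp(2)[OF _ gap gs F] by (simp add: ys su_def s'_def)
          define \<sigma>4 where "\<sigma>4 = set_reg ''E'' (3 * T / 2) (set_reg ''si'' s' (set_reg ''ci'' (real (cls I y))
            (set_reg ''rem'' z (set_reg ''j'' (real (Suc y)) \<sigma>3))))"
          have out4: "out W (Suc (2 * length ys + 1 + (10 * \<phi> + 6 * length ys + 1))) \<sigma>4 ((cs @ gs0) @ [(1, M)])"
            using q(2) L1 by (auto simp: \<sigma>4_def \<sigma>3_def gs elim!: out_mono)
          show ?thesis
            apply (rule exI[of _ i])
            apply (simp add: same s2 si gap_def[symmetric] gap cj y inp' \<sigma>3_def[symmetric] del: of_nat_Suc)
            apply (fold \<sigma>4_def)
            apply (rule run_emit[OF out4, where x = su and i = "cls I y"])
               apply (simp_all add: \<sigma>4_def \<sigma>3_def su_def)[3]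
            subgoal premises q5 for \<sigma>5
            proof -
              have inp4: "inp I T \<sigma>4" using inp2 by (simp add: \<sigma>4_def \<sigma>3_def)
              have inp5: "inp I T \<sigma>5"
                by (rule inp_same[OF inp4 q5(2)]) (auto simp: out_regs_def out_arrs_def)
              have r5: "reg \<sigma>5 ''gap'' = gap" "reg \<sigma>5 ''j'' = real (Suc y)" "reg \<sigma>5 ''rem'' = z"
                "reg \<sigma>5 ''E'' = 3 / 2 * T" "reg \<sigma>5 ''i'' = real i" "arr \<sigma>5 ''nxt'' = arr \<sigma> ''nxt''"
                "arr \<sigma>5 ''head'' = arr \<sigma> ''head''"
                using q5(2) same by (simp_all add: same_def \<sigma>4_def \<sigma>3_def out_regs_def out_arrs_def)
              define \<sigma>6 where "\<sigma>6 = set_reg ''go'' 1 (set_reg ''sp'' gap \<sigma>5)"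
              have inp6: "inp I T \<sigma>6" using inp5 by (simp add: \<sigma>6_def)
              have strm6: "stream I \<sigma>6 ''j'' ''rem'' ys"
                using strm r5 cj by (simp add: stream_def \<sigma>6_def ys)
              have out6: "out W (2 * length ys + 1 + (10 * \<phi> + 6 * length ys + 1)) \<sigma>6 ((cs @ gs0) @ [(1, M @ [su])])"
                using q5(1) by (simp add: \<sigma>6_def)
              show ?thesis
                apply (simp add: r5 \<sigma>6_def[symmetric])
                apply (rule run_fill[OF inp6 strm6 _ val cl W _ _ _ out6 F])
                    apply (simp_all add: \<sigma>6_def r5 ys)[4]
                subgoal premises q7 for t' \<sigma>7
                proof -
                  have r7: "reg \<sigma>7 ''i'' = real i" "arr \<sigma>7 ''nxt'' = arr \<sigma> ''nxt''" "arr \<sigma>7 ''head'' = arr \<sigma> ''head''"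
                    using q7(5) r5 by (simp_all add: same_def \<sigma>6_def fill_regs_def out_regs_def out_arrs_def)
                  have inp7: "inp I T \<sigma>7"
                    by (rule inp_same[OF inp6 q7(5)]) (auto simp: fill_regs_def out_regs_def out_arrs_def)
                  define \<sigma>8 where "\<sigma>8 = set_reg ''i'' (real (Suc i)) (set_reg ''crem'' (reg \<sigma>7 ''rem'')
                    (set_reg ''cj'' (reg \<sigma>7 ''j'') \<sigma>7))"
                  have "out W (10 * \<phi> + 8 * length zs + 1) \<sigma>8 (cs @ gs0 @ [(1, M @ su # its)])"
                    using q7(2) zs by (auto simp: \<sigma>8_def elim!: out_mono)
                  then have "main_inv I T W \<sigma>8 (Suc i) (cs @ gs0 @ [(1, M @ su # its)]) zs"
                    using i prog' q7(3) inp7 ch r7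
                    by (simp add: main_inv_def \<sigma>8_def \<phi>_def stream_def)
                  moreover have "t + t' + 60 + 1 + 300 * \<phi> + 100 * length zs \<le> 300 * jobs_from I i + 100 * length ys"
                    using q(1) q7(1) \<phi> L1 zs by simp
                  ultimately have Q': "k \<le> t + t' + 60 \<Longrightarrow> Q k \<sigma>8" for k by (intro Q) (auto simp: \<phi>_def)
                  show ?thesis
                    using Q'[unfolded \<sigma>8_def] by (simp add: r7 add.commute[of _ 1])
                qed
                done
            qed
            done
        qed
      qed
      done
  qed
qed

section \<open>The whole program and its running time\<close>

definition sched_com :: com where
  "sched_com = seqs [
     Assign ''i'' (N 0), While (Less (V ''i'') (V ''n'')) link_body,
     Assign ''i'' (N 0), While (Less (V ''i'') (V ''c'')) concat_body,
     If (Less (N 0) (V ''cj'')) (Load ''crem'' ''t'' (Minus (V ''cj'') (N 1))) SKIP,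
     Assign ''i'' (N 0), While (Less (V ''i'') (V ''c'')) main_body,
     Assign ''j'' (V ''cj''), Assign ''rem'' (V ''crem''), Assign ''cap'' (V ''T''),
     Assign ''E'' (Divide (Times (N 3) (V ''T'')) (N 2)),
     block_com,
     new_group (Minus (V ''m'') (V ''used''))]"

lemma run_main:
  assumes wf: "wf_inst I" and T: "0 < T" and sT: "\<forall>i<classes I. real (stime I i) \<le> T"
    and W: "jobs I \<le> W" "classes I \<le> W" and small: "\<forall>j<jobs I. real (ptime I j) / (T / 2) \<le> real W"
    and inv: "main_inv I T W \<sigma> 0 [] ys"
    and Q: "\<And>t \<sigma>' cs zs. main_inv I T W \<sigma>' (classes I) cs zs \<Longrightarrow>
      t + 100 * length zs \<le> 300 * jobs_from I 0 + 100 * length ys + 1 \<Longrightarrow> Q t \<sigma>'"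
  shows "run W (While (Less (V ''i'') (V ''c'')) main_body) \<sigma> Q"
proof (rule run_While_potential[where f = "300 * jobs_from I 0 + 100 * length ys" and
      Inv = "\<lambda>f \<tau>. \<exists>i cs zs. main_inv I T W \<tau> i cs zs \<and> f = 300 * jobs_from I i + 100 * length zs"])
  show "\<exists>i cs zs. main_inv I T W \<sigma> i cs zs \<and>
      300 * jobs_from I 0 + 100 * length ys = 300 * jobs_from I i + 100 * length zs"
    using inv by blast
next
  fix f \<tau>
  assume "\<exists>i cs zs. main_inv I T W \<tau> i cs zs \<and> f = 300 * jobs_from I i + 100 * length zs"
    and b: "bval (Less (V ''i'') (V ''c'')) \<tau>"
  then obtain i cs zs where inv: "main_inv I T W \<tau> i cs zs" and f: "f = 300 * jobs_from I i + 100 * length zs"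
    by blast
  have "i < classes I" using inv b by (simp add: main_inv_def inp_def)
  then show "run W main_body \<tau> (\<lambda>k \<sigma>'. \<exists>f'. (\<exists>i cs zs. main_inv I T W \<sigma>' i cs zs \<and>
      f' = 300 * jobs_from I i + 100 * length zs) \<and> k + 1 + f' \<le> f)"
    by (rule run_main_body[OF wf T sT W small inv]) (use f in force)
next
  fix f' \<tau> t
  assume "\<exists>i cs zs. main_inv I T W \<tau> i cs zs \<and> f' = 300 * jobs_from I i + 100 * length zs"
    and b: "\<not> bval (Less (V ''i'') (V ''c'')) \<tau>"
    and t: "t + f' \<le> 300 * jobs_from I 0 + 100 * length ys + 1"
  then obtain i cs zs where inv: "main_inv I T W \<tau> i cs zs" and f: "f' = 300 * jobs_from I i + 100 * length zs"
    by blast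
  have "i = classes I" using inv b by (simp add: main_inv_def inp_def)
  then show "Q t \<tau>" using inv t f by (intro Q) auto
qed

lemma jobs_from_0: "wf_inst I \<Longrightarrow> jobs_from I 0 = jobs I"
proof -
  assume "wf_inst I"
  then have cl: "\<forall>j<jobs I. cls I j < classes I" by (simp add: wf_inst_def)
  have "length (class_list I i) = card (class_jobs I i)" for i
    using distinct_card[of "class_list I i"] by (simp add: set_jobs_upto class_jobs_def)
  then have "jobs_from I 0 = (\<Sum>i<classes I. card (class_jobs I i))"
    by (simp add: jobs_from_def atLeast0LessThan)
  also have "\<dots> = jobs I" using sum_classes[OF cl, of "\<lambda>j. 1 :: nat"] by simp
  finally show ?thesis .
qed

text \<open>Costs per class thereby become costs per job, as time linear in \<open>n\<close>
  requires.\<close>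

lemma classes_le_jobs: "wf_inst I \<Longrightarrow> classes I \<le> jobs I"
proof -
  assume wf: "wf_inst I"
  have "(\<Sum>i\<in>{0..<classes I}. 1) \<le> jobs_from I 0"
    unfolding jobs_from_def using class_list_nonempty[OF wf]
    by (intro sum_mono) (simp add: Suc_le_eq)
  then show ?thesis by (simp add: jobs_from_0[OF wf])
qed

text \<open>18 is 10 + 8 from the reserve in \<open>main_inv\<close>: every job counts once in its
  class and at most once in the cheap stream.\<close>

lemma run_sched:
  assumes wf: "wf_inst I" and T: "0 < T" and sT: "\<forall>i<classes I. real (stime I i) \<le> T"
    and L: "real_of_int (L_split I T) \<le> real (machines I) * T" and m: "m_exp I T \<le> int (machines I)"
    and W: "18 * jobs I + 1 \<le> W" and small: "\<forall>j<jobs I. real (ptime I j) / (T / 2) \<le> real W"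
  shows "run W sched_com (input_state I T) (\<lambda>k \<sigma>. k \<le> 1000 * jobs I \<and>
    (\<exists>cs. outputs \<sigma> cs \<and> feasible I (expand cs) \<and> makespan I (expand cs) \<le> 3 / 2 * T))"
proof -
  define \<sigma>0 where "\<sigma>0 = set_reg ''i'' 0 (input_state I T)"
  have n: "classes I \<le> jobs I" "0 < jobs I" using classes_le_jobs[OF wf] wf by (auto simp: wf_inst_def)
  then have W': "jobs I \<le> W" "classes I \<le> W" using W by linarith+
  have cl: "\<forall>j<jobs I. cls I j < classes I" using wf by (auto simp: wf_inst_def)
  have inp0: "inp I T \<sigma>0" by (simp add: inp_def \<sigma>0_def input_state_def)
  have z0: "reg \<sigma>0 ''i'' = 0" "reg \<sigma>0 ''cj'' = 0" "\<forall>i. arr \<sigma>0 ''head'' i = 0"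
    "reg \<sigma>0 ''groups'' = 0" "reg \<sigma>0 ''p'' = 0" "reg \<sigma>0 ''used'' = 0"
    by (simp_all add: \<sigma>0_def input_state_def)
  define js where "js = cheap_list I T (classes I)"
  let ?ys = "whole I js"
  have "length js = card (set js)" by (simp add: js_def distinct_card[OF distinct_cheap_list])
  also have "\<dots> \<le> card {..<jobs I}" by (rule card_mono) (auto simp: js_def set_cheap_list)
  finally have len: "length ?ys \<le> jobs I" by simp
  show ?thesis
    unfolding sched_com_def
    apply simp
    apply (fold \<sigma>0_def)
    apply (rule run_link[OF inp0 cl W' z0(1,3)])
    subgoal premises q1 for t1 \<sigma>1
    proof -
      define \<sigma>1' where "\<sigma>1' = set_reg ''i'' 0 \<sigma>1"
      have "inp I T \<sigma>1"
        by (rule inp_same[OF inp0 q1(3)]) (auto simp: link_regs_def link_arrs_def)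
      then have inp1: "inp I T \<sigma>1'" by (simp add: \<sigma>1'_def)
      have lk1: "\<forall>i<classes I. linked I (jobs I) \<sigma>1' i" using q1(2) by (simp add: \<sigma>1'_def linked_def)
      have same1: "same link_regs link_arrs \<sigma>0 \<sigma>1'"
        using q1(3) by (simp add: \<sigma>1'_def same_set_reg link_regs_def)
      show ?thesis
        apply (fold \<sigma>1'_def)
        apply (rule run_concat[OF inp1 _ W' _ _ lk1])
           apply (simp add: class_list_nonempty[OF wf])
          apply (simp add: \<sigma>1'_def)
         apply (simp add: \<sigma>1'_def q1(4) z0)
        subgoal premises q2 for t2 \<sigma>2
        proof -
          have inp2: "inp I T \<sigma>2"
            by (rule inp_same[OF inp1 q2(3)]) (auto simp: link_regs_def link_arrs_def)
          have same2: "same link_regs link_arrs \<sigma>0 \<sigma>2" by (rule same_trans[OF same1 q2(3)])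
          have ch: "chain (arr \<sigma>2 ''nxt'') (reg \<sigma>2 ''cj'') js"
            using q2(2) by (simp add: concatenated_def js_def)
          define \<sigma>3 where "\<sigma>3 = set_reg ''i'' 0
            (if js = [] then \<sigma>2 else set_reg ''crem'' (real (ptime I (hd js))) \<sigma>2)"
          have out3: "out W (10 * jobs_from I 0 + 8 * length ?ys + 1) \<sigma>3 []"
            using same2 z0 W len
            by (simp add: out_def outputs_def \<sigma>3_def same_def link_regs_def jobs_from_0[OF wf])
          have strm3: "stream I \<sigma>3 ''cj'' ''crem'' ?ys"
            using ch by (cases js) (auto simp: stream_def \<sigma>3_def whole_def comp_def)
          have inv3: "main_inv I T W \<sigma>3 0 [] ?ys"
            using out3 strm3 progress_init[OF wf L] q2(2) inp2
            by (auto simp: main_inv_def js_def[symmetric] \<sigma>3_def concatenated_def linked_def)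
          have pre: "run W (If (Less (N 0) (V ''cj'')) (Load ''crem'' ''t'' (Minus (V ''cj'') (N 1))) SKIP) \<sigma>2 R \<longleftrightarrow>
              R 2 (if js = [] then \<sigma>2 else set_reg ''crem'' (real (ptime I (hd js))) \<sigma>2)" for R
          proof (cases js)
            case Nil
            then show ?thesis using ch by (simp add: run_If numeral_2_eq_2)
          next
            case (Cons j js')
            then have "j \<in> set js" by simp
            then have j: "j < jobs I" by (simp add: js_def set_cheap_list)
            then have "j \<le> W" "arr \<sigma>2 ''t'' j = real (ptime I j)" using W' inp2 by (simp_all add: inp_def)
            moreover have "reg \<sigma>2 ''cj'' = real (Suc j)" using ch by (simp add: Cons)
            ultimately show ?thesis by (simp add: Cons run_If numeral_2_eq_2 del: of_nat_Suc)
          qed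
          show ?thesis
            apply (subst pre)
            apply (fold \<sigma>3_def)
            apply (rule run_main[OF wf T sT W' small inv3])
            subgoal premises q4 for t4 \<sigma>4 cs zs
            proof -
              have inp4: "inp I T \<sigma>4" and strm4: "stream I \<sigma>4 ''cj'' ''crem'' zs"
                and prog: "progress I T (classes I) cs zs" and out4: "out W (8 * length zs + 1) \<sigma>4 cs"
                using q4(1) by (simp_all add: main_inv_def jobs_from_def)
              define \<sigma>5 where "\<sigma>5 = set_reg ''E'' (3 * T / 2) (set_reg ''cap'' T
                (set_reg ''rem'' (reg \<sigma>4 ''crem'') (set_reg ''j'' (reg \<sigma>4 ''cj'') \<sigma>4)))"
              have inp5: "inp I T \<sigma>5" using inp4 by (simp add: \<sigma>5_def)
              have T4: "reg \<sigma>4 ''T'' = T" using inp4 by (simp add: inp_def)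
              have strm5: "stream I \<sigma>5 ''j'' ''rem'' zs" using strm4 by (simp add: stream_def \<sigma>5_def)
              have out5: "out W (8 * length zs + 1) \<sigma>5 cs" using out4 by (simp add: \<sigma>5_def)
              \<comment> \<open>Shared by both cases below: for empty \<open>zs\<close> the last
                loop is skipped, and this case is separate because \<open>block\<close> with an
                empty rest demands a nonempty list of machines.\<close>
              have finish: "run W (new_group (Minus (V ''m'') (V ''used''))) \<tau> R"
                if gs: "if zs = [] then gs = [] else block I (3 / 2 * T) T zs gs [] sp"
                  and out: "out W (Suc 0) \<tau> (cs @ gs)" and mreg: "reg \<tau> ''m'' = real (machines I)"
                  and R: "\<And>\<tau>' cs'. outputs \<tau>' cs' \<Longrightarrow> feasible I (expand cs') \<Longrightarrow>
                    makespan I (expand cs') \<le> 3 / 2 * T \<Longrightarrow> R 4 \<tau>'" for gs sp \<tau> R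
              proof (rule run_new_group[OF out])
                note fin = progress_final[OF prog T wf m gs]
                have "reg \<tau> ''used'' = real (count (cs @ gs))" using out by (simp only: out_def)
                then show "aval (Minus (V ''m'') (V ''used'')) \<tau> = real (machines I - count (cs @ gs))"
                  using mreg fin(3) by (simp add: of_nat_diff)
                fix \<tau>'
                assume "out W 0 \<tau>' ((cs @ gs) @ [(machines I - count (cs @ gs), [])])"
                then have "outputs \<tau>' ((cs @ gs) @ [(machines I - count (cs @ gs), [])])" by (simp only: out_def)
                then show "R 4 \<tau>'" by (rule R) (use fin(1,2) in simp_all)
              qed
              have "run W block_com \<sigma>5 (\<lambda>k \<sigma>6. k \<le> 150 * length zs + 1 \<and>
                run W (new_group (Minus (V ''m'') (V ''used''))) \<sigma>6 (\<lambda>k \<sigma>'. k = 4 \<and>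
                  (\<exists>cs. outputs \<sigma>' cs \<and> feasible I (expand cs) \<and> makespan I (expand cs) \<le> 3 / 2 * T)))"
              proof (cases "zs = []")
                case True
                then have "reg \<sigma>5 ''j'' = 0" using strm5 by (simp add: stream_def)
                moreover have "run W (new_group (Minus (V ''m'') (V ''used''))) \<sigma>5 (\<lambda>k \<sigma>'. k = 4 \<and>
                  (\<exists>cs. outputs \<sigma>' cs \<and> feasible I (expand cs) \<and> makespan I (expand cs) \<le> 3 / 2 * T))"
                  using True out5 inp5 by (intro finish[of "[]"]) (auto simp: inp_def)
                ultimately show ?thesis unfolding block_com_def by (subst run_While) simp
              next
                case False
                have valid: "valid I zs" and fits: "\<forall>x\<in>set zs. real (stime I (cls I (fst x))) \<le> 3 / 2 * T - T"
                  using prog by (auto simp: progress_def)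
                have "real (ptime I j) / T \<le> real W" if "j < jobs I" for j
                proof -
                  have "real (ptime I j) / T \<le> real (ptime I j) / (T / 2)"
                    using T by (intro divide_left_mono) auto
                  also have "\<dots> \<le> real W" using small that by blast
                  finally show ?thesis .
                qed
                then have small': "\<forall>j<jobs I. real (ptime I j) / T \<le> real W" by blast
                show ?thesis
                proof (rule run_block[OF block_init[OF valid False, of "3 / 2 * T" T "reg \<sigma>5 ''sp''"] inp5 strm5 cl W' T fits small' _ _ refl])
                  show "reg \<sigma>5 ''cap'' = T" "reg \<sigma>5 ''E'' = 3 / 2 * T" by (simp_all add: \<sigma>5_def)
                  show "out W (8 * length zs + Suc 0) \<sigma>5 (cs @ [])" using out5 by simp
                next
                  fix t \<sigma>6 gs sp
                  assume t: "t \<le> 150 * length zs + 1" and out6: "out W (Suc 0) \<sigma>6 (cs @ gs)"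
                    and blk: "block I (3 / 2 * T) T zs gs [] sp" and same: "same block_regs out_arrs \<sigma>5 \<sigma>6"
                  have "inp I T \<sigma>6"
                    by (rule inp_same[OF inp5 same]) (auto simp: block_regs_def fill_regs_def out_regs_def out_arrs_def)
                  then have "run W (new_group (Minus (V ''m'') (V ''used''))) \<sigma>6 (\<lambda>k \<sigma>'. k = 4 \<and>
                    (\<exists>cs. outputs \<sigma>' cs \<and> feasible I (expand cs) \<and> makespan I (expand cs) \<le> 3 / 2 * T))"
                    using False blk out6 by (intro finish[of gs sp]) (auto simp: inp_def)
                  then show "t \<le> 150 * length zs + 1 \<and> run W (new_group (Minus (V ''m'') (V ''used''))) \<sigma>6 (\<lambda>k \<sigma>'. k = 4 \<and>
                    (\<exists>cs. outputs \<sigma>' cs \<and> feasible I (expand cs) \<and> makespan I (expand cs) \<le> 3 / 2 * T))"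
                    using t by blast
                qed
              qed
              \<comment> \<open>The bound on \<open>t4\<close> already holds back 100 steps for each
                job in \<open>zs\<close>; all terms become multiples of \<open>jobs I\<close>, and
                \<open>0 < jobs I\<close> absorbs the constants.\<close>
              moreover have "t1 + t2 + t4 + 150 * length zs + 40 \<le> 1000 * jobs I"
                using q1(1) q2(1) q4(2) n len jobs_from_0[OF wf] by simp
              ultimately show ?thesis
                apply (simp add: T4)
                apply (fold \<sigma>5_def)
                apply (erule run_mono, erule conjE, erule run_mono)
                apply auto
                done
            qed
            done
        qed
        done
    qed
    done
qed

section \<open>Bounds implied by \<open>T_min\<close>, choice of \<open>W\<close>,
  conclusion\<close>

lemma T_min_bounds:
  assumes wf: "wf_inst I" and T: "T_min I \<le> T"
  shows "0 < T" "\<forall>i<classes I. real (stime I i) \<le> T"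
    "\<forall>j<jobs I. real (ptime I j) / (T / 2) \<le> 2 * real (machines I)"
proof -
  have m: "0 < machines I" and n: "0 < jobs I" "\<forall>j<jobs I. 0 < ptime I j"
    using wf by (auto simp: wf_inst_def)
  have "real (total_N I) / real (machines I) \<le> T" using T by (simp add: T_min_def)
  then have N: "real (total_N I) \<le> real (machines I) * T" using m by (simp add: field_simps)
  have p: "ptime I j \<le> total_N I" if "j < jobs I" for j
    using member_le_sum[of j "{..<jobs I}" "ptime I"] that by (simp add: total_N_def load_def)
  have "0 < total_N I" using p[OF n(1)] n by fastforce
  with N have "0 < real (machines I) * T" by linarith
  with m show pos: "0 < T" by (simp add: zero_less_mult_iff)
  show "\<forall>i<classes I. real (stime I i) \<le> T"
  proof (intro allI impI)
    fix i assume "i < classes I"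
    then have "stime I i \<le> s_max I" unfolding s_max_def by (intro Max_ge) auto
    then show "real (stime I i) \<le> T" using T by (simp add: T_min_def)
  qed
  \<comment> \<open>A single job is at most \<open>total_N I\<close> long, hence at most
    \<open>m T\<close>; this bounds every quotient that the program rounds.\<close>
  show "\<forall>j<jobs I. real (ptime I j) / (T / 2) \<le> 2 * real (machines I)"
  proof (intro allI impI)
    fix j assume "j < jobs I"
    then have "real (ptime I j) \<le> real (machines I) * T" using p N by fastforce
    then show "real (ptime I j) / (T / 2) \<le> 2 * real (machines I)" using pos by (simp add: field_simps)
  qed
qed

text \<open>One number has to serve as exponent of the word bound and as factor of the running time,
  hence 1000 in both places.\<close>

lemma sched_com_correct:
  assumes wf: "wf_inst I" and T: "T_min I \<le> T"
    and good: "\<not> (real (machines I) * T < real_of_int (L_split I T) \<or> int (machines I) < m_exp I T)"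
  shows "\<exists>k \<sigma> cs. exec ((jobs I + machines I + 1) ^ 1000) sched_com (input_state I T) k \<sigma> \<and>
    k \<le> 1000 * jobs I \<and> outputs \<sigma> cs \<and> feasible I (expand cs) \<and> makespan I (expand cs) \<le> 3 / 2 * T"
proof -
  define b where "b = jobs I + machines I + 1"
  define W where "W = b ^ 1000"
  note T' = T_min_bounds[OF wf T]
  have "2 \<le> b" using wf by (simp add: b_def wf_inst_def)
  \<comment> \<open>\<open>b \<ge> 2\<close> trades powers for constants: \<open>32 * b\<close>
    bounds both \<open>18 * jobs I + 1\<close> and \<open>2 * machines I\<close>.\<close>
  then have "(2 :: nat) ^ 5 * b \<le> b ^ 5 * b" by (intro mult_right_mono power_mono) auto
  also have "\<dots> = b ^ 6" by (simp add: power_Suc2[symmetric] del: power_Suc2)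
  also have "\<dots> \<le> W" using \<open>2 \<le> b\<close> unfolding W_def by (intro power_increasing) auto
  finally have W: "32 * b \<le> W" by simp
  then have "real (2 * machines I) \<le> real W" by (simp add: b_def del: of_nat_mult)
  then have "\<forall>j<jobs I. real (ptime I j) / (T / 2) \<le> real W"
    using T'(3) by fastforce
  moreover have "18 * jobs I + 1 \<le> W" using W by (simp add: b_def)
  ultimately have "run W sched_com (input_state I T) (\<lambda>k \<sigma>. k \<le> 1000 * jobs I \<and>
      (\<exists>cs. outputs \<sigma> cs \<and> feasible I (expand cs) \<and> makespan I (expand cs) \<le> 3 / 2 * T))"
    using good by (intro run_sched wf T') auto
  then show ?thesis unfolding run_def W_def b_def by blast
qed

text \<open>\<open>OPT_split\<close> is an infimum, which is informative only over a nonempty set; a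
  schedule comes from the algorithm itself, run with a large makespan.\<close>

lemma feasible_schedule_exists:
  assumes wf: "wf_inst I"
  shows "\<exists>S. feasible I S"
proof -
  \<comment> \<open>So large that no class is expensive (\<open>s_max \<le> T / 2\<close>) and that
    \<open>L_split = N \<le> T\<close>; hence neither rejection test applies.\<close>
  define T where "T = 2 * real (s_max I) + real (total_N I)"
  have m: "0 < machines I" using wf by (simp add: wf_inst_def)
  have "real (total_N I) / real (machines I) \<le> real (total_N I) / 1"
    using m by (intro divide_left_mono) auto
  then have T: "T_min I \<le> T" by (simp add: T_min_def T_def)
  have "stime I i \<le> s_max I" if "i < classes I" for i
    using that unfolding s_max_def by (intro Max_ge) auto
  then have e: "I_exp I T = {}" "I_chp I T = {..<classes I}"
    unfolding I_exp_def I_chp_def T_def by (fastforce simp: not_less)+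
  have "L_split I T = int (total_N I)" by (simp add: L_split_def e total_N_def)
  moreover have "1 * T \<le> real (machines I) * T" using m by (intro mult_right_mono) (auto simp: T_def)
  then have "real (total_N I) \<le> real (machines I) * T" by (simp add: T_def)
  ultimately show ?thesis using sched_com_correct[OF wf T] by (auto simp: m_exp_def e)
qed

theorem theoremC1:
  shows
    "(\<forall>(I :: inst) (T :: real). wf_inst I \<and> T \<ge> T_min I \<longrightarrow>
        (real (machines I) * T < real_of_int (L_split I T) \<or> int (machines I) < m_exp I T) \<longrightarrow>
        T < OPT_split I)
     \<and>
     (\<exists>(p :: com) (K :: nat). \<forall>(I :: inst) (T :: real). wf_inst I \<and> T \<ge> T_min I \<longrightarrow>
        \<not> (real (machines I) * T < real_of_int (L_split I T) \<or> int (machines I) < m_exp I T) \<longrightarrow>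
        (\<exists>(k :: nat) (\<sigma> :: state) (cs :: csched).
           exec ((jobs I + machines I + 1) ^ K) p (input_state I T) k \<sigma> \<and>
           k \<le> K * jobs I \<and>
           outputs \<sigma> cs \<and>
           feasible I (expand cs) \<and>
           makespan I (expand cs) \<le> 3 / 2 * T))"
  using OPT_split_gt T_min_bounds(1) feasible_schedule_exists sched_com_correct by blast

end
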